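(* Let $\mathcal N,\mathcal M\in\mathrm{CPTP}(A\to B)$ and $r>0$. Then the error exponent under coherent strategies without quantum memory assistance satisfies $$\mathrm{E}^{\mathrm{er}}_{\mathrm{COH}}(r|\mathcal N\|\mathcal M)\ge\sup_{0<\alpha<1}\frac{\alpha-1}{\alpha}\left[r-\bar d_\alpha^{\,\mathrm{reg}}(\mathcal N\|\mathcal M)\right].$$
   Context: All Hilbert spaces are finite-dimensional; $\mathfrak{D}(A)$ is the set of density operators on $A$, $\mathrm{CPTP}(A\to B)$ the set of quantum channels, $\log$ is base two. For $\alpha\in(0,1)$, $\bar D_\alpha(\rho\|\sigma)=\frac1{\alpha-1}\log\operatorname{Tr}[\rho^\alpha\sigma^{1-\alpha}]$ (Petz Rényi divergence, $+\infty$ if the trace vanishes), $\bar d_\alpha(\mathcal N\|\mathcal M)=\sup_{\rho\in\mathfrak{D}(A)}\bar D_\alpha(\mathcal N(\rho)\|\mathcal M(\rho))$, and $\bar d_\alpha^{\,\mathrm{reg}}(\mathcal N\|\mathcal M)=\sup_{m\in\mathbb N}\frac1m\bar d_\alpha(\mathcal N^{\otimes m}\|\mathcal M^{\otimes m})$. A coherent strategy without quantum memory with $n$ channel uses is a pair $(\psi_n,\Pi_n)$ with $\psi_n\in\mathfrak{D}(A^n)$ and a test $0\le\Pi_n\le I$ on $B^n$; its errors are $\alpha_n=\operatorname{Tr}[(I-\Pi_n)\mathcal N^{\otimes n}(\psi_n)]$ (Type-I) and $\beta_n=\operatorname{Tr}[\Pi_n\mathcal M^{\otimes n}(\psi_n)]$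 (Type-II). The error exponent is $$\mathrm{E}^{\mathrm{er}}_{\mathrm{COH}}(r|\mathcal N\|\mathcal M)=\sup\Big\{-\limsup_{n\to\infty}\frac1n\log\alpha_n:\ \limsup_{n\to\infty}\frac1n\log\beta_n\le-r\Big\},$$ where the supremum is over all sequences (indexed by $n\in\mathbb N$) of coherent strategies satisfying the constraint. *)

theory Defs
  imports
    "HOL-Library.Extended_Real"
    "HOL-Library.Liminf_Limsup"
    "Jordan_Normal_Form.Matrix"
    "Jordan_Normal_Form.Conjugate"
    "Jordan_Normal_Form.Schur_Decomposition"
begin

text \<open>A finite-dimensional Hilbert space is represented by its dimension, with a fixed orthonormal
  basis; operators are complex matrices, and the tensor product of spaces of dimension \<open>m\<close> and \<open>n\<close>
  is the space of dimension \<open>m * n\<close> with the basis vector \<open>(i, k)\<close> stored at index \<open>i * n + k\<close>.\<close>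

subsection \<open>Operators\<close>

definition mat_trace :: "complex mat \<Rightarrow> complex" where
  "mat_trace A = (\<Sum>i<dim_row A. A $$ (i, i))"

text \<open>The order is the one on the complex numbers, in which \<open>0 \<le> z\<close> says that \<open>z\<close> is real and
  nonnegative; in particular \<open>psd\<close> matrices are Hermitian.\<close>

definition psd :: "nat \<Rightarrow> complex mat \<Rightarrow> bool" where
  "psd n A \<longleftrightarrow> A \<in> carrier_mat n n \<and> (\<forall>v\<in>carrier_vec n. 0 \<le> (A *\<^sub>v v) \<bullet>c v)"

definition density_op :: "nat \<Rightarrow> complex mat \<Rightarrow> bool" where
  "density_op n \<rho> \<longleftrightarrow> psd n \<rho> \<and> mat_trace \<rho> = 1"

definition effect :: "nat \<Rightarrow> complex mat \<Rightarrow> bool" where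
  "effect n T \<longleftrightarrow> psd n T \<and> psd n (1\<^sub>m n - T)"

definition spectral_form :: "nat \<Rightarrow> complex mat \<Rightarrow> (nat \<Rightarrow> real) \<Rightarrow> complex mat" where
  "spectral_form n U d = U * mat_diag n (\<lambda>i. complex_of_real (d i)) * mat_adjoint U"

definition unitary :: "nat \<Rightarrow> complex mat \<Rightarrow> bool" where
  "unitary n U \<longleftrightarrow> U \<in> carrier_mat n n \<and> mat_adjoint U * U = 1\<^sub>m n \<and> U * mat_adjoint U = 1\<^sub>m n"

text \<open>Functional calculus: apply \<open>x \<mapsto> x\<^sup>s\<close> to the eigenvalues. The result does not depend on the
  chosen diagonalization (see \<open>mat_powr_spectral_form\<close> below). Only positive semidefinite matrices
  and exponents \<open>0 < s < 1\<close> are relevant, and \<open>0 powr s = 0\<close>.\<close>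

definition mat_powr :: "complex mat \<Rightarrow> real \<Rightarrow> complex mat" where
  "mat_powr A s = (SOME B. \<exists>U d. unitary (dim_row A) U \<and> A = spectral_form (dim_row A) U d \<and>
      B = spectral_form (dim_row A) U (\<lambda>i. d i powr s))"

lemma spectral_form_unique:
  assumes U: "unitary n U" and V: "unitary n V" and eq: "spectral_form n U d = spectral_form n V e"
  shows "spectral_form n U (\<lambda>i. d i powr s) = spectral_form n V (\<lambda>i. e i powr s)"
proof -
  define D where "D f = mat_diag n (\<lambda>i. complex_of_real (f i))" for f :: "nat \<Rightarrow> real"
  have D: "D f \<in> carrier_mat n n" for f by (simp add: D_def)
  have Uc: "U \<in> carrier_mat n n" and Vc: "V \<in> carrier_mat n n"
    using U V by (auto simp: unitary_def)
  have Ua: "mat_adjoint U \<in> carrier_mat n n" and Va: "mat_adjoint V \<in> carrier_mat n n"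
    using Uc Vc unfolding mat_adjoint_def by (intro carrier_matI; simp)+
  define W where "W = mat_adjoint V * U"
  have W: "W \<in> carrier_mat n n" using Va Uc by (simp add: W_def)
  have swap: "mat_adjoint V * (spectral_form n U f) * U = W * D f" for f
  proof -
    have "mat_adjoint V * (U * D f * mat_adjoint U) * U
        = mat_adjoint V * U * D f * (mat_adjoint U * U)"
      using Uc Ua Va D[of f] by (simp add: assoc_mult_mat[of _ n n _ n _ n])
    also have "\<dots> = W * D f"
      using U W D[of f] by (simp add: unitary_def W_def)
    finally show ?thesis by (simp add: spectral_form_def D_def)
  qed
  have swap': "mat_adjoint V * (spectral_form n V f) * U = D f * W" for f
  proof -
    have "mat_adjoint V * (V * D f * mat_adjoint V) * U
        = (mat_adjoint V * V) * D f * (mat_adjoint V * U)"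
      using Uc Vc Va D[of f] by (simp add: assoc_mult_mat[of _ n n _ n _ n])
    also have "\<dots> = D f * W"
      using V W D[of f] by (simp add: unitary_def W_def)
    finally show ?thesis by (simp add: spectral_form_def D_def)
  qed
  have WD: "W * D d = D e * W" using swap[of d] swap'[of e] eq by simp
  have entry: "W $$ (i, j) * complex_of_real (d j) = complex_of_real (e i) * W $$ (i, j)"
    if "i < n" "j < n" for i j
    using arg_cong[OF WD, of "\<lambda>X. X $$ (i, j)"] that
    unfolding D_def mat_diag_mult_right[OF W] mat_diag_mult_left[OF W] by simp
  have "W * D (\<lambda>i. d i powr s) = D (\<lambda>i. e i powr s) * W"
  proof (rule eq_matI)
    fix i j assume "i < dim_row (D (\<lambda>i. e i powr s) * W)" "j < dim_col (D (\<lambda>i. e i powr s) * W)"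
    then have ij: "i < n" "j < n" using W D by (auto simp: D_def mat_diag_def)
    have "W $$ (i, j) = 0 \<or> d j = e i"
      using entry[OF ij] by (metis mult.commute mult_cancel_left of_real_eq_iff)
    then show "(W * D (\<lambda>i. d i powr s)) $$ (i, j) = (D (\<lambda>i. e i powr s) * W) $$ (i, j)"
      using ij unfolding D_def mat_diag_mult_right[OF W] mat_diag_mult_left[OF W] by auto
  qed (use W D in \<open>auto simp: D_def mat_diag_def\<close>)
  then have *: "mat_adjoint V * spectral_form n U (\<lambda>i. d i powr s) * U
      = mat_adjoint V * spectral_form n V (\<lambda>i. e i powr s) * U"
    by (simp add: swap swap')
  have cancel: "V * (mat_adjoint V * X * U) * mat_adjoint U = X" if X: "X \<in> carrier_mat n n" for X
  proof -
    have "V * (mat_adjoint V * X * U) * mat_adjoint U = (V * mat_adjoint V) * X * (U * mat_adjoint U)"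
      using X Uc Ua Vc Va by (simp add: assoc_mult_mat[of _ n n _ n _ n])
    then show ?thesis using X U V by (simp add: unitary_def)
  qed
  have "spectral_form n U f \<in> carrier_mat n n" "spectral_form n V f \<in> carrier_mat n n" for f
    unfolding spectral_form_def
    using mult_carrier_mat[OF mult_carrier_mat[OF Uc D] Ua] mult_carrier_mat[OF mult_carrier_mat[OF Vc D] Va]
    by (simp_all add: D_def)
  then show ?thesis by (metis * cancel)
qed

lemma mat_powr_spectral_form:
  assumes U: "unitary n U"
  shows "mat_powr (spectral_form n U d) s = spectral_form n U (\<lambda>i. d i powr s)"
proof -
  have dim: "dim_row (spectral_form n U d) = n"
    using U by (auto simp: unitary_def spectral_form_def)
  show ?thesis
    unfolding mat_powr_def dim
  proof (rule some_equality)
    show "\<exists>U' d'. unitary n U' \<and> spectral_form n U d = spectral_form n U' d' \<and>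
      spectral_form n U (\<lambda>i. d i powr s) = spectral_form n U' (\<lambda>i. d' i powr s)"
      using U by blast
  next
    fix B assume "\<exists>U' d'. unitary n U' \<and> spectral_form n U d = spectral_form n U' d' \<and>
      B = spectral_form n U' (\<lambda>i. d' i powr s)"
    then show "B = spectral_form n U (\<lambda>i. d i powr s)"
      using spectral_form_unique[OF U] by metis
  qed
qed

subsection \<open>Channels\<close>

definition kron :: "complex mat \<Rightarrow> complex mat \<Rightarrow> complex mat" where
  "kron A B = mat (dim_row A * dim_row B) (dim_col A * dim_col B)
     (\<lambda>(p, q). A $$ (p div dim_row B, q div dim_col B) * B $$ (p mod dim_row B, q mod dim_col B))"

definition mat_unit :: "nat \<Rightarrow> nat \<Rightarrow> nat \<Rightarrow> complex mat" where
  "mat_unit n i j = mat n n (\<lambda>(p, q). if p = i \<and> q = j then 1 else 0)"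

definition linear_mat_map :: "nat \<Rightarrow> nat \<Rightarrow> (complex mat \<Rightarrow> complex mat) \<Rightarrow> bool" where
  "linear_mat_map a b \<Phi> \<longleftrightarrow>
     (\<forall>X\<in>carrier_mat a a. \<Phi> X \<in> carrier_mat b b) \<and>
     (\<forall>X\<in>carrier_mat a a. \<forall>Y\<in>carrier_mat a a. \<Phi> (X + Y) = \<Phi> X + \<Phi> Y) \<and>
     (\<forall>c. \<forall>X\<in>carrier_mat a a. \<Phi> (c \<cdot>\<^sub>m X) = c \<cdot>\<^sub>m \<Phi> X)"

text \<open>The tensor product of linear maps between matrix spaces (dimensions \<open>a1\<close> to \<open>b1\<close> and \<open>a2\<close> to
  \<open>b2\<close>): expand the argument in the basis \<open>kron (mat_unit a1 i j) (mat_unit a2 k l)\<close> and extend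
  linearly from product matrices; see \<open>map_tensor_kron\<close> below.\<close>

definition map_tensor :: "nat \<Rightarrow> nat \<Rightarrow> nat \<Rightarrow> nat \<Rightarrow>
    (complex mat \<Rightarrow> complex mat) \<Rightarrow> (complex mat \<Rightarrow> complex mat) \<Rightarrow> complex mat \<Rightarrow> complex mat" where
  "map_tensor a1 b1 a2 b2 \<Phi> \<Psi> X = mat (b1 * b2) (b1 * b2) (\<lambda>pq.
     \<Sum>i<a1. \<Sum>j<a1. \<Sum>k<a2. \<Sum>l<a2.
       X $$ (i * a2 + k, j * a2 + l) * kron (\<Phi> (mat_unit a1 i j)) (\<Psi> (mat_unit a2 k l)) $$ pq)"

lemma linear_mat_map_expand:
  assumes lin: "linear_mat_map a b \<Phi>" and X: "X \<in> carrier_mat a a" and pq: "p < b" "q < b"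
  shows "\<Phi> X $$ (p, q) = (\<Sum>i<a. \<Sum>j<a. X $$ (i, j) * \<Phi> (mat_unit a i j) $$ (p, q))"
proof -
  have c: "\<Phi> Y \<in> carrier_mat b b" if "Y \<in> carrier_mat a a" for Y
    using lin that by (auto simp: linear_mat_map_def)
  have E: "mat_unit a i j \<in> carrier_mat a a" for i j by (simp add: mat_unit_def)
  define P where "P S = mat a a (\<lambda>ij. if ij \<in> S then X $$ ij else 0)" for S
  have Pc: "P S \<in> carrier_mat a a" for S by (simp add: P_def)
  have "\<Phi> (P S) $$ (p, q) = (\<Sum>(i, j)\<in>S. X $$ (i, j) * \<Phi> (mat_unit a i j) $$ (p, q))"
    if "finite S" for S using that
  proof induction
    case empty
    have "P {} = 0 \<cdot>\<^sub>m P {}" by (auto simp: P_def)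
    then have "\<Phi> (P {}) = 0 \<cdot>\<^sub>m \<Phi> (P {})" using lin Pc by (metis linear_mat_map_def)
    then have "\<Phi> (P {}) $$ (p, q) = (0 \<cdot>\<^sub>m \<Phi> (P {})) $$ (p, q)" by simp
    also have "\<dots> = 0" using c[OF Pc[of "{}"]] pq by simp
    finally show ?case by simp
  next
    case (insert x S)
    obtain i j where x: "x = (i, j)" by force
    have "P (insert x S) = X $$ x \<cdot>\<^sub>m mat_unit a i j + P S"
      using insert x by (intro eq_matI) (auto simp: P_def mat_unit_def)
    then have "\<Phi> (P (insert x S)) = X $$ x \<cdot>\<^sub>m \<Phi> (mat_unit a i j) + \<Phi> (P S)"
      using lin Pc E by (simp add: linear_mat_map_def)
    then show ?case
      using insert x pq c[OF Pc[of S]] c[OF E[of i j]] by simp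
  qed
  from this[of "{..<a} \<times> {..<a}"] have "\<Phi> (P ({..<a} \<times> {..<a})) $$ (p, q)
      = (\<Sum>(i, j)\<in>{..<a} \<times> {..<a}. X $$ (i, j) * \<Phi> (mat_unit a i j) $$ (p, q))" by simp
  moreover have "P ({..<a} \<times> {..<a}) = X" using X by (auto simp: P_def)
  ultimately show ?thesis by (simp add: sum.cartesian_product)
qed

lemma map_tensor_kron:
  assumes \<Phi>: "linear_mat_map a1 b1 \<Phi>" and \<Psi>: "linear_mat_map a2 b2 \<Psi>"
    and X: "X \<in> carrier_mat a1 a1" and Y: "Y \<in> carrier_mat a2 a2"
  shows "map_tensor a1 b1 a2 b2 \<Phi> \<Psi> (kron X Y) = kron (\<Phi> X) (\<Psi> Y)"
proof -
  have c1: "\<Phi> Z \<in> carrier_mat b1 b1" if "Z \<in> carrier_mat a1 a1" for Z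
    using \<Phi> that by (auto simp: linear_mat_map_def)
  have c2: "\<Psi> Z \<in> carrier_mat b2 b2" if "Z \<in> carrier_mat a2 a2" for Z
    using \<Psi> that by (auto simp: linear_mat_map_def)
  have E1: "mat_unit a1 i j \<in> carrier_mat a1 a1" and E2: "mat_unit a2 i j \<in> carrier_mat a2 a2" for i j
    by (simp_all add: mat_unit_def)
  have d1: "dim_row (\<Phi> (mat_unit a1 i j)) = b1" "dim_col (\<Phi> (mat_unit a1 i j)) = b1" for i j
    using c1[OF E1[of i j]] by auto
  have d2: "dim_row (\<Psi> (mat_unit a2 i j)) = b2" "dim_col (\<Psi> (mat_unit a2 i j)) = b2" for i j
    using c2[OF E2[of i j]] by auto
  have dX: "dim_row (\<Phi> X) = b1" "dim_col (\<Phi> X) = b1" "dim_row (\<Psi> Y) = b2" "dim_col (\<Psi> Y) = b2"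
    using c1[OF X] c2[OF Y] by auto
  have idx: "i * a2 + k < a1 * a2" if "i < a1" "k < a2" for i k
  proof -
    have "i * a2 + k < Suc i * a2" using that by simp
    also have "\<dots> \<le> a1 * a2" using that by (intro mult_right_mono) auto
    finally show ?thesis .
  qed
  have kronXY: "kron X Y $$ (i * a2 + k, j * a2 + l) = X $$ (i, j) * Y $$ (k, l)"
    if "i < a1" "j < a1" "k < a2" "l < a2" for i j k l
    using X Y that idx by (simp add: kron_def)
  show ?thesis
  proof (rule eq_matI)
    fix p q assume "p < dim_row (kron (\<Phi> X) (\<Psi> Y))" "q < dim_col (kron (\<Phi> X) (\<Psi> Y))"
    then have pq: "p < b1 * b2" "q < b1 * b2" by (auto simp: kron_def dX)
    then have b2: "b2 > 0" by (cases b2) auto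
    have m: "p div b2 < b1" "q div b2 < b1" "p mod b2 < b2" "q mod b2 < b2"
      using pq b2 by (auto simp: less_mult_imp_div_less)
    have "map_tensor a1 b1 a2 b2 \<Phi> \<Psi> (kron X Y) $$ (p, q) =
      (\<Sum>i<a1. \<Sum>j<a1. \<Sum>k<a2. \<Sum>l<a2. (X $$ (i, j) * \<Phi> (mat_unit a1 i j) $$ (p div b2, q div b2)) *
         (Y $$ (k, l) * \<Psi> (mat_unit a2 k l) $$ (p mod b2, q mod b2)))"
      using pq by (auto simp: map_tensor_def kronXY kron_def[of "\<Phi> _"] d1 d2 mult_ac intro!: sum.cong)
    also have "\<dots> = \<Phi> X $$ (p div b2, q div b2) * \<Psi> Y $$ (p mod b2, q mod b2)"
      unfolding linear_mat_map_expand[OF \<Phi> X m(1,2)] linear_mat_map_expand[OF \<Psi> Y m(3,4)]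
        sum_distrib_right
      unfolding sum_distrib_left ..
    also have "\<dots> = kron (\<Phi> X) (\<Psi> Y) $$ (p, q)" using pq by (simp add: kron_def dX)
    finally show "map_tensor a1 b1 a2 b2 \<Phi> \<Psi> (kron X Y) $$ (p, q) = kron (\<Phi> X) (\<Psi> Y) $$ (p, q)" .
  qed (simp_all add: map_tensor_def kron_def dX)
qed

definition completely_positive :: "nat \<Rightarrow> nat \<Rightarrow> (complex mat \<Rightarrow> complex mat) \<Rightarrow> bool" where
  "completely_positive a b \<Phi> \<longleftrightarrow>
     (\<forall>k X. psd (k * a) X \<longrightarrow> psd (k * b) (map_tensor k k a b (\<lambda>Y. Y) \<Phi> X))"

definition cptp :: "nat \<Rightarrow> nat \<Rightarrow> (complex mat \<Rightarrow> complex mat) \<Rightarrow> bool" where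
  "cptp a b \<Phi> \<longleftrightarrow> linear_mat_map a b \<Phi> \<and> completely_positive a b \<Phi> \<and>
     (\<forall>X\<in>carrier_mat a a. mat_trace (\<Phi> X) = mat_trace X)"

primrec map_tensor_power ::
    "nat \<Rightarrow> nat \<Rightarrow> (complex mat \<Rightarrow> complex mat) \<Rightarrow> nat \<Rightarrow> complex mat \<Rightarrow> complex mat" where
  "map_tensor_power a b \<Phi> 0 = (\<lambda>X. X)"
| "map_tensor_power a b \<Phi> (Suc n) =
     map_tensor a b (a ^ n) (b ^ n) \<Phi> (map_tensor_power a b \<Phi> n)"

subsection \<open>Divergences\<close>

text \<open>The traces below are real for density operators, so \<open>Re\<close> only changes the type.\<close>

definition petz_div :: "real \<Rightarrow> complex mat \<Rightarrow> complex mat \<Rightarrow> ereal" where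
  "petz_div \<alpha> \<rho> \<sigma> = (let Q = Re (mat_trace (mat_powr \<rho> \<alpha> * mat_powr \<sigma> (1 - \<alpha>)))
     in if Q = 0 then \<infinity> else ereal (1 / (\<alpha> - 1) * log 2 Q))"

definition channel_div :: "real \<Rightarrow> nat \<Rightarrow>
    (complex mat \<Rightarrow> complex mat) \<Rightarrow> (complex mat \<Rightarrow> complex mat) \<Rightarrow> ereal" where
  "channel_div \<alpha> a N M = (SUP \<rho>\<in>{\<rho>. density_op a \<rho>}. petz_div \<alpha> (N \<rho>) (M \<rho>))"

definition reg_channel_div :: "real \<Rightarrow> nat \<Rightarrow> nat \<Rightarrow>
    (complex mat \<Rightarrow> complex mat) \<Rightarrow> (complex mat \<Rightarrow> complex mat) \<Rightarrow> ereal" where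
  "reg_channel_div \<alpha> a b N M =
     (SUP m\<in>{1..}. ereal (1 / real m) *
        channel_div \<alpha> (a ^ m) (map_tensor_power a b N m) (map_tensor_power a b M m))"

subsection \<open>Coherent strategies without quantum memory\<close>

text \<open>Logarithm of an error probability, with \<open>log 0 = -\<infinity>\<close>.\<close>

definition elog2 :: "real \<Rightarrow> ereal" where
  "elog2 x = (if x \<le> 0 then -\<infinity> else ereal (log 2 x))"

definition type1_error :: "nat \<Rightarrow> nat \<Rightarrow> (complex mat \<Rightarrow> complex mat) \<Rightarrow> nat \<Rightarrow>
    complex mat \<Rightarrow> complex mat \<Rightarrow> real" where
  "type1_error a b N n \<psi> T = Re (mat_trace ((1\<^sub>m (b ^ n) - T) * map_tensor_power a b N n \<psi>))"

definition type2_error :: "nat \<Rightarrow> nat \<Rightarrow> (complex mat \<Rightarrow> complex mat) \<Rightarrow> nat \<Rightarrow>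
    complex mat \<Rightarrow> complex mat \<Rightarrow> real" where
  "type2_error a b M n \<psi> T = Re (mat_trace (T * map_tensor_power a b M n \<psi>))"

definition coh_strategies :: "nat \<Rightarrow> nat \<Rightarrow> ((nat \<Rightarrow> complex mat) \<times> (nat \<Rightarrow> complex mat)) set" where
  "coh_strategies a b = {(\<psi>, T). \<forall>n\<ge>1. density_op (a ^ n) (\<psi> n) \<and> effect (b ^ n) (T n)}"

definition error_exponent_coh :: "real \<Rightarrow> nat \<Rightarrow> nat \<Rightarrow>
    (complex mat \<Rightarrow> complex mat) \<Rightarrow> (complex mat \<Rightarrow> complex mat) \<Rightarrow> ereal" where
  "error_exponent_coh r a b N M =
     Sup {- limsup (\<lambda>n. ereal (1 / real n) * elog2 (type1_error a b N n (\<psi> n) (T n))) | \<psi> T.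
       (\<psi>, T) \<in> coh_strategies a b \<and>
       limsup (\<lambda>n. ereal (1 / real n) * elog2 (type2_error a b M n (\<psi> n) (T n))) \<le> ereal (- r)}"

end

theory Submission
  imports
    "HOL-Analysis.Equivalence_Lebesgue_Henstock_Integration"
    Defs
    "Jordan_Normal_Form.Spectral_Radius"
begin

unbundle no vec_syntax and no inner_syntax

text \<open>By superadditivity, the regularized divergence is approached by inputs built from copies of one
  good block input: if \<open>c\<close> is below it, some block \<open>\<rho>\<close> of length \<open>m\<close> has overlap
  \<open>Q = Tr[N(\<rho>)\<^sup>\<alpha> M(\<rho>)\<^sup>1\<^sup>-\<^sup>\<alpha>] \<le> \<theta>\<^sup>m\<close> with \<open>\<theta> = 2\<^sup>-\<^sup>(\<^sup>1\<^sup>-\<^sup>\<alpha>\<^sup>)\<^sup>c\<close>, and since \<open>Q\<close> is multiplicative,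
  tensor powers of \<open>\<rho>\<close> (padded by an arbitrary state) have overlap at most \<open>K \<theta>\<^sup>n\<close> for every \<open>n\<close>.
  Audenaert's inequality \<open>min\<^sub>T Tr[(1 - T)A] + Tr[T B] \<le> Tr[A\<^sup>\<alpha> B\<^sup>1\<^sup>-\<^sup>\<alpha>]\<close>, applied to the two channel
  outputs with the second one rescaled so that the type-II error is at most \<open>2\<^sup>-\<^sup>n\<^sup>r\<close>, then bounds the
  type-I error. Audenaert's inequality follows from operator monotonicity of \<open>x\<^sup>s\<close>, which in turn
  follows from that of \<open>x / (x + t)\<close> by integration over \<open>t\<close>.\<close>

subsection \<open>Quadratic forms and unitary coordinates\<close>

text \<open>The exponent comes from one choice of scale. If the overlap is at most L and the second
  output is multiplied by l, Audenaert's inequality bounds the type-I error plus l times the type-II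
  error by l^(1-\<alpha>) L. Requiring this to equal l 2^(-x) with x = n r fixes l^\<alpha> = L 2^x,
  and L = K \<theta>^n then gives the type-I exponent (1-\<alpha>)/\<alpha> (c - r). The number c
  stays strictly below the regularized divergence, which may be infinite and need not be attained.
  Bounds at multiples of m alone would not do, since the exponents are upper limits over all n; this
  is the origin of the constant K. A second obstacle lies in the channels: complete positivity is
  stated for an identity factor on the left, whereas outputs of tensor powers have to be positive.
  Kraus operators bridge the two, because they multiply under tensor products.\<close>

lemma mat_adjoint_index:
  "i < dim_col A \<Longrightarrow> j < dim_row A \<Longrightarrow> mat_adjoint A $$ (i, j) = cnj (A $$ (j, i))"
  for A :: "complex mat"
  by (simp add: mat_adjoint_def mat_of_rows_def)

lemma mat_adjoint_dim [simp]:
  "dim_row (mat_adjoint A) = dim_col A" "dim_col (mat_adjoint A) = dim_row A"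
  by (simp_all add: mat_adjoint_def)

lemma mat_adjoint_carrier: "A \<in> carrier_mat n m \<Longrightarrow> mat_adjoint A \<in> carrier_mat m n"
  by (metis carrier_matD carrier_matI mat_adjoint_dim)

lemma mult_mat_index:
  assumes "A \<in> carrier_mat n m" "B \<in> carrier_mat m k" "i < n" "j < k"
  shows "(A * B) $$ (i, j) = (\<Sum>l<m. A $$ (i, l) * B $$ (l, j))"
  using assms by (simp add: scalar_prod_def atLeast0LessThan)

text \<open>Vectors are functions on all of \<open>nat\<close>, of which only the values below
  \<open>n\<close> count; this removes carrier conditions from test vectors.\<close>

definition qform :: "nat \<Rightarrow> complex mat \<Rightarrow> (nat \<Rightarrow> complex) \<Rightarrow> complex" where
  "qform n A f = (\<Sum>i<n. \<Sum>j<n. cnj (f i) * A $$ (i, j) * f j)"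

lemma psd_iff_qform: "psd n A \<longleftrightarrow> A \<in> carrier_mat n n \<and> (\<forall>f. 0 \<le> qform n A f)"
proof -
  have *: "(A *\<^sub>v v) \<bullet>c v = qform n A (\<lambda>i. v $ i)" if "A \<in> carrier_mat n n" "v \<in> carrier_vec n" for v
  proof -
    have "(A *\<^sub>v v) \<bullet>c v = (\<Sum>i<n. (\<Sum>j<n. A $$ (i, j) * v $ j) * cnj (v $ i))"
      using that by (simp add: scalar_prod_def atLeast0LessThan)
    then show ?thesis by (simp add: qform_def sum_distrib_right sum_distrib_left mult_ac)
  qed
  have "0 \<le> qform n A f" if A: "A \<in> carrier_mat n n" and v: "\<forall>v\<in>carrier_vec n. 0 \<le> (A *\<^sub>v v) \<bullet>c v" for f
  proof -
    have "qform n A f = qform n A (\<lambda>i. vec n f $ i)" by (simp add: qform_def)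
    then show ?thesis using *[OF A, of "vec n f"] v by (metis vec_carrier)
  qed
  then show ?thesis using * by (auto simp: psd_def)
qed

lemma psd_carrier: "psd n A \<Longrightarrow> A \<in> carrier_mat n n"
  by (simp add: psd_def)

lemma qform_add:
  "A \<in> carrier_mat n n \<Longrightarrow> B \<in> carrier_mat n n \<Longrightarrow> qform n (A + B) f = qform n A f + qform n B f"
  by (simp add: qform_def algebra_simps sum.distrib)

lemma qform_minus:
  "A \<in> carrier_mat n n \<Longrightarrow> B \<in> carrier_mat n n \<Longrightarrow> qform n (A - B) f = qform n A f - qform n B f"
  by (simp add: qform_def algebra_simps sum_subtractf)

lemma qform_smult: "A \<in> carrier_mat n n \<Longrightarrow> qform n (c \<cdot>\<^sub>m A) f = c * qform n A f"
  by (simp add: qform_def sum_distrib_left mult_ac)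

lemma psd_add: "psd n A \<Longrightarrow> psd n B \<Longrightarrow> psd n (A + B)"
  by (auto simp: psd_iff_qform qform_add)

lemma psd_smult: "psd n A \<Longrightarrow> 0 \<le> c \<Longrightarrow> psd n (complex_of_real c \<cdot>\<^sub>m A)"
  by (auto simp: psd_iff_qform qform_smult less_eq_complex_def)

text \<open>Polarization: the form is real at e_i + c e_j, and comparing c with -c, for c = 1 and
  for c the imaginary unit, isolates the off-diagonal entries. The same formula covers i =
  j.\<close>

lemma psd_hermitian:
  assumes "psd n A" "i < n" "j < n"
  shows "A $$ (j, i) = cnj (A $$ (i, j))"
proof -
  define e where "e c k = (if k = i then 1 else 0) + c * (if k = j then 1 else 0)" for c :: complex and k
  have q: "qform n A (e c) = A $$ (i, i) + c * A $$ (i, j) + cnj c * A $$ (j, i) + cnj c * c * A $$ (j, j)" for c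
  proof -
    have e: "(\<Sum>k<n. g k * e c k) = g i + c * g j" for g c
    proof -
      have "g k * e c k = (if k = i then g k else 0) + (if k = j then c * g k else 0)" for k
        by (simp add: e_def algebra_simps)
      then show ?thesis using assms by (simp add: sum.distrib)
    qed
    have e': "cnj (e c k) = e (cnj c) k" for k by (simp add: e_def)
    have "qform n A (e c) = (\<Sum>k<n. (\<Sum>l<n. A $$ (k, l) * e c l) * e (cnj c) k)"
      by (simp add: qform_def e' sum_distrib_left mult_ac)
    then show ?thesis unfolding e by (simp add: algebra_simps)
  qed
  have "0 \<le> qform n A (e c)" for c using assms by (simp add: psd_iff_qform)
  from this[of 0] this[of 1] this[of "-1"] this[of \<i>] this[of "-\<i>"] show ?thesis
    unfolding q by (simp add: less_eq_complex_def complex_eq_iff)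
qed

lemma unitary_carrier: "unitary n U \<Longrightarrow> U \<in> carrier_mat n n"
  by (simp add: unitary_def)

lemma unitary_cols:
  assumes "unitary n U" "k < n" "l < n"
  shows "(\<Sum>i<n. cnj (U $$ (i, k)) * U $$ (i, l)) = (if k = l then 1 else 0)"
proof -
  have U: "U \<in> carrier_mat n n" using assms by (simp add: unitary_def)
  have "(mat_adjoint U * U) $$ (k, l) = (1\<^sub>m n :: complex mat) $$ (k, l)"
    using assms by (simp add: unitary_def)
  then show ?thesis
    using assms(2,3) U mult_mat_index[OF mat_adjoint_carrier[OF U] U assms(2,3)]
    by (simp add: mat_adjoint_index)
qed

lemma unitary_rows:
  assumes "unitary n U" "k < n" "l < n"
  shows "(\<Sum>i<n. U $$ (k, i) * cnj (U $$ (l, i))) = (if k = l then 1 else 0)"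
proof -
  have U: "U \<in> carrier_mat n n" using assms by (simp add: unitary_def)
  have "(U * mat_adjoint U) $$ (k, l) = (1\<^sub>m n :: complex mat) $$ (k, l)"
    using assms by (simp add: unitary_def)
  then show ?thesis
    using assms(2,3) U mult_mat_index[OF U mat_adjoint_carrier[OF U] assms(2,3)]
    by (simp add: mat_adjoint_index)
qed

lemma unitaryI:
  assumes U: "U \<in> carrier_mat n n"
    and cols: "\<And>k l. k < n \<Longrightarrow> l < n \<Longrightarrow> (\<Sum>i<n. cnj (U $$ (i, k)) * U $$ (i, l)) = (if k = l then 1 else 0)"
  shows "unitary n U"
proof -
  have a: "mat_adjoint U * U = 1\<^sub>m n"
    using U mult_mat_index[OF mat_adjoint_carrier[OF U] U] cols
    by (intro eq_matI) (auto simp: mat_adjoint_index)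
  then have "U * mat_adjoint U = 1\<^sub>m n"
    using mat_mult_left_right_inverse[OF mat_adjoint_carrier[OF U] U] by simp
  with a U show ?thesis by (simp add: unitary_def)
qed

lemma spectral_form_carrier: "U \<in> carrier_mat n n \<Longrightarrow> spectral_form n U d \<in> carrier_mat n n"
  unfolding spectral_form_def
  by (intro mult_carrier_mat[of _ n n] mat_adjoint_carrier) (auto simp: mat_diag_def)

lemma spectral_form_index:
  assumes U: "U \<in> carrier_mat n n" and ij: "i < n" "j < n"
  shows "spectral_form n U d $$ (i, j) = (\<Sum>k<n. U $$ (i, k) * d k * cnj (U $$ (j, k)))"
proof -
  have D: "U * mat_diag n (\<lambda>i. complex_of_real (d i)) \<in> carrier_mat n n"
    using U by (intro mult_carrier_mat[of _ n n]) (auto simp: mat_diag_def)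
  show ?thesis
    unfolding spectral_form_def
    using mult_mat_index[OF D mat_adjoint_carrier[OF U] ij] U ij
    by (simp add: mat_diag_mult_right[OF U] mat_adjoint_index)
qed

lemma spectral_form_cong: "U \<in> carrier_mat n n \<Longrightarrow> (\<And>k. k < n \<Longrightarrow> d k = e k) \<Longrightarrow> spectral_form n U d = spectral_form n U e"
  using spectral_form_carrier[of U n d] spectral_form_carrier[of U n e]
  by (intro eq_matI) (simp_all add: spectral_form_index carrier_matD)

text \<open>Entry \<open>k\<close> of the adjoint of \<open>U\<close> applied to \<open>f\<close>,
  that is, the coefficient of \<open>f\<close> along column \<open>k\<close> when \<open>U\<close>
  is unitary.\<close>

definition coord :: "nat \<Rightarrow> complex mat \<Rightarrow> (nat \<Rightarrow> complex) \<Rightarrow> nat \<Rightarrow> complex" where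
  "coord n U f k = (\<Sum>i<n. cnj (U $$ (i, k)) * f i)"

lemma qform_spectral_form:
  assumes U: "U \<in> carrier_mat n n"
  shows "qform n (spectral_form n U d) f = (\<Sum>k<n. d k * (cmod (coord n U f k))\<^sup>2)"
proof -
  have "qform n (spectral_form n U d) f
      = (\<Sum>i<n. \<Sum>j<n. \<Sum>k<n. d k * ((cnj (f i) * U $$ (i, k)) * (cnj (U $$ (j, k)) * f j)))"
    unfolding qform_def using U
    by (intro sum.cong) (simp_all add: spectral_form_index sum_distrib_left sum_distrib_right mult_ac)
  also have "\<dots> = (\<Sum>i<n. \<Sum>k<n. \<Sum>j<n. d k * ((cnj (f i) * U $$ (i, k)) * (cnj (U $$ (j, k)) * f j)))"
    by (intro sum.cong refl sum.swap)
  also have "\<dots> = (\<Sum>k<n. \<Sum>i<n. \<Sum>j<n. d k * ((cnj (f i) * U $$ (i, k)) * (cnj (U $$ (j, k)) * f j)))"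
    by (rule sum.swap)
  also have "\<dots> = (\<Sum>k<n. d k * (cnj (coord n U f k) * coord n U f k))"
    by (simp add: coord_def sum_distrib_left sum_distrib_right mult_ac)
  finally show ?thesis by (simp add: complex_norm_square[symmetric] mult.commute[of "cnj _"])
qed

lemma coord_unitary_col:
  assumes "unitary n U" "k < n" "l < n"
  shows "coord n U (\<lambda>i. U $$ (i, l)) k = (if k = l then 1 else 0)"
  using unitary_cols[OF assms] by (simp add: coord_def)

lemma coord_inverse:
  assumes "unitary n U" "i < n"
  shows "(\<Sum>k<n. U $$ (i, k) * coord n U f k) = f i"
proof -
  have "(\<Sum>k<n. U $$ (i, k) * coord n U f k) = (\<Sum>j<n. (\<Sum>k<n. U $$ (i, k) * cnj (U $$ (j, k))) * f j)"
    by (simp add: coord_def sum_distrib_left sum_distrib_right mult_ac) (rule sum.swap)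
  also have "\<dots> = (\<Sum>j<n. (if i = j then 1 else 0) * f j)"
    using assms by (intro sum.cong) (simp_all add: unitary_rows)
  also have "\<dots> = f i" using assms by (simp add: if_distrib[of "\<lambda>x. x * _"] cong: if_cong)
  finally show ?thesis .
qed

lemma coord_parseval:
  assumes "unitary n U"
  shows "(\<Sum>i<n. cnj (g i) * f i) = (\<Sum>k<n. cnj (coord n U g k) * coord n U f k)"
proof -
  have "(\<Sum>k<n. cnj (coord n U g k) * coord n U f k)
     = (\<Sum>k<n. \<Sum>i<n. cnj (g i) * U $$ (i, k) * coord n U f k)"
    by (simp add: coord_def[of n U g] sum_distrib_left sum_distrib_right mult_ac)
  also have "\<dots> = (\<Sum>i<n. cnj (g i) * (\<Sum>k<n. U $$ (i, k) * coord n U f k))"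
    by (subst sum.swap) (simp add: sum_distrib_left mult_ac)
  also have "\<dots> = (\<Sum>i<n. cnj (g i) * f i)" using assms by (simp add: coord_inverse)
  finally show ?thesis ..
qed

lemma psd_spectral_form:
  assumes U: "U \<in> carrier_mat n n" and d: "\<And>k. k < n \<Longrightarrow> 0 \<le> d k"
  shows "psd n (spectral_form n U d)"
  unfolding psd_iff_qform qform_spectral_form[OF U]
  using spectral_form_carrier[OF U] d by (auto simp: less_eq_complex_def intro!: sum_nonneg)

text \<open>Column \<open>k\<close> of \<open>U\<close> is a test vector at which the quadratic form
  takes the value \<open>d k\<close>.\<close>

lemma psd_spectral_form_nonneg:
  assumes U: "unitary n U" and psd: "psd n (spectral_form n U d)" and k: "k < n"
  shows "0 \<le> d k"
proof -
  have "qform n (spectral_form n U d) (\<lambda>i. U $$ (i, k))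
      = complex_of_real (\<Sum>l<n. d l * (cmod (coord n U (\<lambda>i. U $$ (i, k)) l))\<^sup>2)"
    using qform_spectral_form[OF unitary_carrier[OF U]] by simp
  also have "(\<Sum>l<n. d l * (cmod (coord n U (\<lambda>i. U $$ (i, k)) l))\<^sup>2) = (\<Sum>l<n. if l = k then d l else 0)"
    using k by (intro sum.cong) (simp_all add: coord_unitary_col[OF U])
  also have "\<dots> = d k" using k by simp
  finally show ?thesis
    using psd unfolding psd_iff_qform by (metis less_eq_complex_def Re_complex_of_real zero_complex.sel(1))
qed

subsection \<open>The spectral theorem\<close>

lemma mat_adjoint_mult:
  assumes "A \<in> carrier_mat n m" "B \<in> carrier_mat m k"
  shows "mat_adjoint (A * B) = mat_adjoint B * mat_adjoint (A :: complex mat)"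
proof (rule eq_matI)
  fix i j assume "i < dim_row (mat_adjoint B * mat_adjoint A)" "j < dim_col (mat_adjoint B * mat_adjoint A)"
  then have ij: "i < k" "j < n" using assms by auto
  have "mat_adjoint (A * B) $$ (i, j) = cnj ((A * B) $$ (j, i))"
    using assms ij by (intro mat_adjoint_index) auto
  also have "\<dots> = (\<Sum>l<m. cnj (B $$ (l, i)) * cnj (A $$ (j, l)))"
    using mult_mat_index[OF assms ij(2,1)] by (simp add: mult.commute)
  also have "\<dots> = (\<Sum>l<m. mat_adjoint B $$ (i, l) * mat_adjoint A $$ (l, j))"
    using assms ij by (intro sum.cong) (simp_all add: mat_adjoint_index)
  also have "\<dots> = (mat_adjoint B * mat_adjoint A) $$ (i, j)"
    using mult_mat_index[OF mat_adjoint_carrier[OF assms(2)] mat_adjoint_carrier[OF assms(1)] ij] by simp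
  finally show "mat_adjoint (A * B) $$ (i, j) = (mat_adjoint B * mat_adjoint A) $$ (i, j)" .
qed (use assms in auto)

lemma unitary_mult:
  assumes U: "unitary n U" and V: "unitary n V"
  shows "unitary n (U * V)"
proof -
  have c: "U \<in> carrier_mat n n" "V \<in> carrier_mat n n" "mat_adjoint U \<in> carrier_mat n n" "mat_adjoint V \<in> carrier_mat n n"
    using U V by (auto simp: unitary_def intro!: mat_adjoint_carrier)
  have "mat_adjoint (U * V) * (U * V) = mat_adjoint V * (mat_adjoint U * U) * V"
    using c by (simp add: mat_adjoint_mult[OF c(1,2)] assoc_mult_mat[of _ n n _ n _ n])
  also have "\<dots> = 1\<^sub>m n" using U V c by (simp add: unitary_def)
  finally have 1: "mat_adjoint (U * V) * (U * V) = 1\<^sub>m n" .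
  have "(U * V) * mat_adjoint (U * V) = U * (V * mat_adjoint V) * mat_adjoint U"
    using c by (simp add: mat_adjoint_mult[OF c(1,2)] assoc_mult_mat[of _ n n _ n _ n])
  also have "\<dots> = 1\<^sub>m n" using U V c by (simp add: unitary_def)
  finally show ?thesis using 1 c by (simp add: unitary_def)
qed

text \<open>Gram-Schmidt keeps the first vector of the completed basis, so the first column is a
  multiple of \<open>v\<close>. The vectors it returns are orthogonal but not normalized, hence the
  division by \<open>sqrt (s j)\<close>.\<close>

lemma unitary_with_first_column:
  fixes v :: "complex vec"
  assumes v: "v \<in> carrier_vec n" "v \<noteq> 0\<^sub>v n" and n: "0 < n"
  shows "\<exists>W c. unitary n W \<and> (\<forall>i<n. W $$ (i, 0) = c * v $ i)"
proof -
  interpret cof_vec_space n "TYPE(complex)" .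
  define b where "b = basis_completion v"
  define ws where "ws = gram_schmidt n b"
  from basis_completion[OF v, folded b_def]
  have dist_b: "distinct b" and indep: "\<not> lin_dep (set b)" and b: "set b \<subseteq> carrier_vec n"
    and hdb: "hd b = v" and len_b: "length b = n" by auto
  from hdb len_b n obtain vs where bv: "b = v # vs" by (cases b) auto
  from gram_schmidt_result[OF b dist_b indep refl, folded ws_def]
  have ws: "set ws \<subseteq> carrier_vec n" "corthogonal ws" "length ws = n" by (auto simp: len_b)
  from gram_schmidt_hd[OF v(1), of vs, folded bv] have "hd ws = v" unfolding ws_def .
  then have ws0: "ws ! 0 = v" using ws(3) n by (cases ws) auto
  define s where "s j = (\<Sum>i<n. (cmod (ws ! j $ i))\<^sup>2)" for j
  have car: "ws ! j \<in> carrier_vec n" if "j < n" for j using ws that by auto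
  have ip: "ws ! j \<bullet>c ws ! k = (\<Sum>i<n. ws ! j $ i * cnj (ws ! k $ i))" if "j < n" "k < n" for j k
    using car[OF that(1)] car[OF that(2)] by (simp add: scalar_prod_def atLeast0LessThan)
  have orth: "(\<Sum>i<n. ws ! j $ i * cnj (ws ! k $ i)) = 0 \<longleftrightarrow> j \<noteq> k" if "j < n" "k < n" for j k
    using corthogonalD[OF ws(2), of j k] ws(3) ip that by simp
  have self: "(\<Sum>i<n. ws ! j $ i * cnj (ws ! j $ i)) = complex_of_real (s j)" for j
    by (simp add: s_def complex_norm_square[symmetric])
  have s: "0 < s j" if "j < n" for j
  proof -
    have "s j \<noteq> 0" using orth[OF that that] self[of j] by simp
    moreover have "0 \<le> s j" by (simp add: s_def sum_nonneg)
    ultimately show ?thesis by simp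
  qed
  define W where "W = mat n n (\<lambda>(i, j). ws ! j $ i / sqrt (s j))"
  have "unitary n W"
  proof (rule unitaryI)
    show "W \<in> carrier_mat n n" by (simp add: W_def)
    fix k l assume kl: "k < n" "l < n"
    have "(\<Sum>i<n. cnj (W $$ (i, k)) * W $$ (i, l))
        = (\<Sum>i<n. ws ! l $ i * cnj (ws ! k $ i)) / (sqrt (s k) * sqrt (s l))"
      using kl by (simp add: W_def sum_divide_distrib mult_ac)
    also have "\<dots> = (if k = l then 1 else 0)"
    proof (cases "k = l")
      case True
      then have "(\<Sum>i<n. ws ! l $ i * cnj (ws ! k $ i)) = complex_of_real (s l)" using self by simp
      moreover have "complex_of_real (sqrt (s k)) * complex_of_real (sqrt (s l)) = complex_of_real (s l)"
        using True s[OF kl(2)] by (simp add: of_real_mult[symmetric] del: of_real_mult)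
      ultimately show ?thesis using True s[OF kl(2)] by simp
    next
      case False
      then show ?thesis using orth[OF kl(2,1)] by simp
    qed
    finally show "(\<Sum>i<n. cnj (W $$ (i, k)) * W $$ (i, l)) = (if k = l then 1 else 0)" .
  qed
  moreover have "W $$ (i, 0) = (1 / sqrt (s 0)) * v $ i" if "i < n" for i
    using that n ws0 by (simp add: W_def)
  ultimately show ?thesis by blast
qed

text \<open>Weaker than \<open>psd\<close> on purpose: the difference whose positive part is taken
  later may have eigenvalues of either sign, and so may the blocks in the spectral
  induction.\<close>

definition hermitian :: "nat \<Rightarrow> complex mat \<Rightarrow> bool" where
  "hermitian n A \<longleftrightarrow> A \<in> carrier_mat n n \<and> (\<forall>i<n. \<forall>j<n. A $$ (j, i) = cnj (A $$ (i, j)))"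

lemma hermitian_adjoint: "hermitian n A \<Longrightarrow> mat_adjoint A = A"
  unfolding hermitian_def by (intro eq_matI) (metis carrier_matD mat_adjoint_index, auto)

lemma hermitianI: "A \<in> carrier_mat n n \<Longrightarrow> mat_adjoint A = A \<Longrightarrow> hermitian n A"
  unfolding hermitian_def using mat_adjoint_index[of _ A] by (metis carrier_matD)

lemma mat_adjoint_adjoint: "mat_adjoint (mat_adjoint A) = (A :: complex mat)"
  by (intro eq_matI) (auto simp: mat_adjoint_index)

text \<open>Deflation: in an orthonormal basis that starts with an eigenvector, the first column is
  a multiple of the first unit vector, symmetry forces the same on the first row, and the remaining
  Hermitian block is diagonalized by induction.\<close>

lemma hermitian_spectral:
  "hermitian n A \<Longrightarrow> \<exists>U d. unitary n U \<and> A = spectral_form n U d"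
proof (induction n arbitrary: A)
  case 0
  have "unitary 0 (1\<^sub>m 0)" by (rule unitaryI) auto
  moreover have "A = spectral_form 0 (1\<^sub>m 0) d" for d
    using 0 spectral_form_carrier[of "1\<^sub>m 0" 0 d] by (intro eq_matI) (auto simp: hermitian_def)
  ultimately show ?case by blast
next
  case (Suc n)
  let ?N = "Suc n"
  have A: "A \<in> carrier_mat ?N ?N" using Suc.prems by (simp add: hermitian_def)
  obtain e v where ev: "v \<in> carrier_vec ?N" "v \<noteq> 0\<^sub>v ?N" "A *\<^sub>v v = e \<cdot>\<^sub>v v"
    using spectrum_non_empty[OF A] A by (auto simp: spectrum_def eigenvalue_def eigenvector_def)
  obtain W c where W: "unitary ?N W" and W0: "\<And>i. i < ?N \<Longrightarrow> W $$ (i, 0) = c * v $ i"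
    using unitary_with_first_column[OF ev(1,2)] by auto
  have Wc: "W \<in> carrier_mat ?N ?N" "mat_adjoint W \<in> carrier_mat ?N ?N"
    using unitary_carrier[OF W] by (auto intro: mat_adjoint_carrier)
  define M where "M = mat_adjoint W * (A * W)"
  have Mc: "M \<in> carrier_mat ?N ?N" using Wc A by (simp add: M_def)
  have "mat_adjoint M = M"
    using A Wc hermitian_adjoint[OF Suc.prems] unfolding M_def
    by (simp add: mat_adjoint_mult[of _ ?N ?N _ ?N] mat_adjoint_adjoint assoc_mult_mat[of _ ?N ?N _ ?N _ ?N])
  then have Mh: "hermitian ?N M" using Mc by (rule hermitianI[rotated])
  have AW0: "(A * W) $$ (i, 0) = e * W $$ (i, 0)" if i: "i < ?N" for i
  proof -
    have "(A * W) $$ (i, 0) = c * (\<Sum>l<?N. A $$ (i, l) * v $ l)"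
      using mult_mat_index[OF A Wc(1) i, of 0] W0 by (simp add: sum_distrib_left mult_ac del: sum.lessThan_Suc)
    also have "(\<Sum>l<?N. A $$ (i, l) * v $ l) = (A *\<^sub>v v) $ i"
      using A ev(1) i by (simp add: scalar_prod_def atLeast0LessThan del: sum.lessThan_Suc)
    also have "\<dots> = e * v $ i" using ev i by simp
    finally show ?thesis using W0[OF i] by simp
  qed
  have M0: "M $$ (i, 0) = (if i = 0 then e else 0)" if i: "i < ?N" for i
  proof -
    have "M $$ (i, 0) = (\<Sum>l<?N. mat_adjoint W $$ (i, l) * (A * W) $$ (l, 0))"
      unfolding M_def using mult_mat_index[OF Wc(2) _ i, of "A * W" ?N 0] A Wc by simp
    also have "\<dots> = e * (\<Sum>l<?N. cnj (W $$ (l, i)) * W $$ (l, 0))"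
      using i Wc by (simp add: AW0 mat_adjoint_index sum_distrib_left mult_ac del: sum.lessThan_Suc)
    finally show ?thesis using unitary_cols[OF W i, of 0] by simp
  qed
  have Msym: "M $$ (j, i) = cnj (M $$ (i, j))" if "i < ?N" "j < ?N" for i j
    using Mh that unfolding hermitian_def by blast
  have M0': "M $$ (0, j) = (if j = 0 then e else 0)" if j: "j < ?N" for j
    using Msym[OF j, of 0] M0[OF j] Msym[of 0 0] M0[of 0] by auto
  \<comment> \<open>The eigenvalue was found over the complex numbers; being a diagonal entry of a
    Hermitian matrix it is real, as \<open>spectral_form\<close> demands.\<close>
  have "e = cnj e" using Msym[of 0 0] M0[of 0] by simp
  then have er: "complex_of_real (Re e) = e" by (metis Reals_cnj_iff of_real_Re)
  define A' where "A' = mat n n (\<lambda>(i, j). M $$ (Suc i, Suc j))"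
  have "hermitian n A'" unfolding hermitian_def A'_def by (auto intro: Msym)
  from Suc.IH[OF this] obtain U' d' where U': "unitary n U'" and A': "A' = spectral_form n U' d'" by blast
  \<comment> \<open>The direct sum of the scalar 1 and \<open>U'\<close>.\<close>
  define V where "V = mat ?N ?N (\<lambda>(i, j). case i of 0 \<Rightarrow> (if j = 0 then 1 else 0)
      | Suc i' \<Rightarrow> (case j of 0 \<Rightarrow> 0 | Suc j' \<Rightarrow> U' $$ (i', j')))"
  define d where "d = case_nat (Re e) d'"
  have Vc: "V \<in> carrier_mat ?N ?N" by (simp add: V_def)
  have V: "unitary ?N V"
  proof (rule unitaryI[OF Vc])
    fix k l assume "k < ?N" "l < ?N"
    then show "(\<Sum>i<?N. cnj (V $$ (i, k)) * V $$ (i, l)) = (if k = l then 1 else 0)"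
      unfolding sum.lessThan_Suc_shift
      by (cases k; cases l) (simp_all add: V_def unitary_cols[OF U'])
  qed
  have MV: "M = spectral_form ?N V d"
  proof (rule eq_matI)
    fix i j assume "i < dim_row (spectral_form ?N V d)" "j < dim_col (spectral_form ?N V d)"
    then have ij: "i < ?N" "j < ?N" using spectral_form_carrier[OF Vc, of d] by auto
    have s: "M $$ (Suc i', Suc j') = (\<Sum>k<n. U' $$ (i', k) * d' k * cnj (U' $$ (j', k)))" if "i' < n" "j' < n" for i' j'
      using arg_cong[OF A', of "\<lambda>X. X $$ (i', j')"] spectral_form_index[OF unitary_carrier[OF U'] that] that
      by (simp add: A'_def)
    show "M $$ (i, j) = spectral_form ?N V d $$ (i, j)"
      unfolding spectral_form_index[OF Vc ij] sum.lessThan_Suc_shift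
      using ij M0[of i] M0'[of j] er
      by (cases i; cases j) (simp_all add: V_def d_def s)
  qed (use Mc spectral_form_carrier[OF Vc, of d] in auto)
  define D where "D = mat_diag ?N (\<lambda>i. complex_of_real (d i))"
  have Dc: "D \<in> carrier_mat ?N ?N" by (simp add: D_def)
  have Vc': "mat_adjoint V \<in> carrier_mat ?N ?N" using Vc by (rule mat_adjoint_carrier)
  have "W * M * mat_adjoint W = (W * mat_adjoint W) * A * (W * mat_adjoint W)"
    using A Wc by (simp add: M_def assoc_mult_mat[of _ ?N ?N _ ?N _ ?N])
  also have "\<dots> = A" using A W by (simp add: unitary_def)
  finally have "A = W * M * mat_adjoint W" ..
  also have "\<dots> = spectral_form ?N (W * V) d"
    unfolding MV spectral_form_def mat_adjoint_mult[OF Wc(1) Vc] D_def[symmetric]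
    using Wc Vc Vc' Dc by (simp add: assoc_mult_mat[of _ ?N ?N _ ?N _ ?N])
  finally show ?case using unitary_mult[OF W V] by blast
qed

lemma psd_spectral:
  assumes "psd n A"
  obtains U d where "unitary n U" "A = spectral_form n U d" "\<And>k. k < n \<Longrightarrow> 0 \<le> d k"
proof -
  have "hermitian n A" using psd_hermitian[OF assms] psd_carrier[OF assms] unfolding hermitian_def by blast
  from hermitian_spectral[OF this] obtain U d where "unitary n U" "A = spectral_form n U d" by blast
  with assms psd_spectral_form_nonneg that show ?thesis by blast
qed

section \<open>Powers of positive operators and traces of products\<close>

lemma mat_powr_carrier: "psd n A \<Longrightarrow> mat_powr A s \<in> carrier_mat n n"
  by (metis psd_spectral mat_powr_spectral_form spectral_form_carrier unitary_carrier)

lemma psd_mat_powr: "psd n A \<Longrightarrow> psd n (mat_powr A s)"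
  by (metis psd_spectral mat_powr_spectral_form psd_spectral_form unitary_carrier powr_ge_zero)

lemma mat_trace_mult:
  assumes "A \<in> carrier_mat n m" "B \<in> carrier_mat m n"
  shows "mat_trace (A * B) = (\<Sum>i<n. \<Sum>j<m. A $$ (i, j) * B $$ (j, i))"
  using assms mult_mat_index[OF assms] by (simp add: mat_trace_def)

lemma mat_trace_mult_spectral_form:
  assumes A: "A \<in> carrier_mat n n" and U: "U \<in> carrier_mat n n"
  shows "mat_trace (A * spectral_form n U d) = (\<Sum>k<n. d k * qform n A (\<lambda>i. U $$ (i, k)))"
proof -
  have "mat_trace (A * spectral_form n U d)
      = (\<Sum>i<n. \<Sum>j<n. \<Sum>k<n. d k * (cnj (U $$ (i, k)) * A $$ (i, j) * U $$ (j, k)))"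
    unfolding mat_trace_mult[OF A spectral_form_carrier[OF U]]
    by (intro sum.cong refl) (simp add: spectral_form_index[OF U] sum_distrib_left mult_ac)
  also have "\<dots> = (\<Sum>i<n. \<Sum>k<n. \<Sum>j<n. d k * (cnj (U $$ (i, k)) * A $$ (i, j) * U $$ (j, k)))"
    by (intro sum.cong refl sum.swap)
  also have "\<dots> = (\<Sum>k<n. \<Sum>i<n. \<Sum>j<n. d k * (cnj (U $$ (i, k)) * A $$ (i, j) * U $$ (j, k)))"
    by (rule sum.swap)
  finally show ?thesis by (simp add: qform_def sum_distrib_left mult_ac)
qed

text \<open>In an eigenbasis of \<open>B\<close> the trace combines values of the quadratic form of
  \<open>A\<close> with the eigenvalues of \<open>B\<close> as nonnegative weights.\<close>

lemma psd_trace_mult_nonneg: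
  assumes A: "psd n A" and B: "psd n B"
  shows "0 \<le> Re (mat_trace (A * B))"
proof -
  obtain U d where U: "unitary n U" "B = spectral_form n U d" "\<And>k. k < n \<Longrightarrow> 0 \<le> d k"
    using psd_spectral[OF B] by blast
  have "0 \<le> Re (qform n A f)" for f using A by (simp add: psd_iff_qform less_eq_complex_def)
  with U(3) show ?thesis
    unfolding U(2) mat_trace_mult_spectral_form[OF psd_carrier[OF A] unitary_carrier[OF U(1)]]
    by (auto intro!: sum_nonneg)
qed

lemma spectral_form_mult:
  assumes U: "unitary n U"
  shows "spectral_form n U d * spectral_form n U e = spectral_form n U (\<lambda>i. d i * e i)"
proof -
  define D where "D f = mat_diag n (\<lambda>i. complex_of_real (f i))" for f :: "nat \<Rightarrow> real"
  have D: "D f \<in> carrier_mat n n" for f by (simp add: D_def)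
  have c: "U \<in> carrier_mat n n" "mat_adjoint U \<in> carrier_mat n n"
    using unitary_carrier[OF U] by (auto intro: mat_adjoint_carrier)
  have DD: "D d * D e = D (\<lambda>i. d i * e i)"
    by (simp add: D_def)
  have "spectral_form n U d * spectral_form n U e = U * (D d * (mat_adjoint U * U) * D e) * mat_adjoint U"
    unfolding spectral_form_def D_def[symmetric]
    using c D[of d] D[of e] by (simp add: assoc_mult_mat[of _ n n _ n _ n])
  also have "\<dots> = spectral_form n U (\<lambda>i. d i * e i)"
    using U D[of d] D[of e] DD by (simp add: unitary_def spectral_form_def) (simp add: D_def)
  finally show ?thesis .
qed

text \<open>The exponents add up to 1 on each eigenvalue; on the kernel the identity holds because
  \<open>0 powr x = 0\<close>.\<close>

lemma mat_powr_mult: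
  assumes A: "psd n A"
  shows "mat_powr A s * mat_powr A (1 - s) = A"
proof -
  obtain U d where U: "unitary n U" "A = spectral_form n U d" "\<And>k. k < n \<Longrightarrow> 0 \<le> d k"
    using psd_spectral[OF A] by blast
  show ?thesis
    unfolding U(2) mat_powr_spectral_form[OF U(1)] spectral_form_mult[OF U(1)]
    using U(3) by (intro spectral_form_cong unitary_carrier[OF U(1)]) (simp add: powr_add[symmetric])
qed

subsection \<open>Operator monotonicity of powers and Audenaert's inequality\<close>

text \<open>The substitution t = x u pulls out the factor x^s and leaves the integral at x = 1 as
  the constant \<open>k\<close>. Its exact value is left open, since a common positive factor
  cancels in comparisons. Nonnegative integrals avoid separate integrability proofs.\<close>

lemma powr_integral_representation:
  fixes s :: real
  assumes s: "0 < s" "s < 1"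
  defines "G \<equiv> \<lambda>x t. if 0 < t then t powr (s - 1) * (x / (x + t)) else 0"
  obtains k where "0 < k" "\<And>x. 0 \<le> x \<Longrightarrow> (\<integral>\<^sup>+t. ennreal (G x t) \<partial>lborel) = ennreal (x powr s * k)"
proof -
  have meas [measurable]: "G x \<in> borel_measurable borel" for x
    unfolding G_def by measurable
  define K where "K = (\<integral>\<^sup>+t. ennreal (G 1 t) \<partial>lborel)"
  \<comment> \<open>\<open>G 1\<close> is dominated by t^(s-1) on [0, 1] and by t^(s-2) beyond 1;
    their integrals are 1/s and 1/(1-s).\<close>
  define f1 where "f1 t = indicator {0..1} t * t powr (s - 1)" for t :: real
  define f2 where "f2 t = indicator {1..} t * t powr (s - 2)" for t :: real
  have "(\<integral>\<^sup>+t. ennreal (f1 t) \<partial>lborel) = 1 powr (s - 1 + 1) / (s - 1 + 1)"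
    unfolding f1_def by (rule nn_integral_has_integral_lebesgue) (use s has_integral_powr_from_0[of "s - 1" 1] in auto)
  moreover have "(\<integral>\<^sup>+t. ennreal (f2 t) \<partial>lborel) = - (1 powr (s - 2 + 1)) / (s - 2 + 1)"
    unfolding f2_def by (rule nn_integral_has_integral_lebesgue) (use s has_integral_powr_to_inf[of "s - 2" 1] in auto)
  moreover have "K \<le> (\<integral>\<^sup>+t. ennreal (f1 t) + ennreal (f2 t) \<partial>lborel)"
    unfolding K_def
  proof (intro nn_integral_mono)
    fix t :: real
    have "G 1 t \<le> f1 t + f2 t"
    proof (cases "0 < t")
      case True
      have "t powr (s - 1) * (1 / (1 + t)) \<le> t powr (s - 1) * 1" using True by (intro mult_left_mono) auto
      moreover have "t powr (s - 1) * (1 / (1 + t)) \<le> t powr (s - 1) * (1 / t)"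
        using True by (intro mult_left_mono divide_left_mono) auto
      moreover have "t powr (s - 1) * (1 / t) = t powr (s - 2)"
        using True powr_diff[of t "s - 1" 1] by (simp add: algebra_simps)
      ultimately show ?thesis using True by (auto simp: G_def f1_def f2_def indicator_def)
    qed (simp add: G_def f1_def f2_def)
    then show "ennreal (G 1 t) \<le> ennreal (f1 t) + ennreal (f2 t)"
      by (simp add: f1_def f2_def ennreal_plus[symmetric] ennreal_leI del: ennreal_plus)
  qed
  moreover have "(\<integral>\<^sup>+t. ennreal (f1 t) + ennreal (f2 t) \<partial>lborel)
      = (\<integral>\<^sup>+t. ennreal (f1 t) \<partial>lborel) + (\<integral>\<^sup>+t. ennreal (f2 t) \<partial>lborel)"
    by (rule nn_integral_add) (simp_all add: f1_def f2_def)
  ultimately have "K < \<infinity>" by (auto intro: le_less_trans)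
  moreover have "0 < K"
  proof -
    \<comment> \<open>On [1/2, 1] the factors satisfy t^(s-1) \<ge> 1 and 1/(1+t) \<ge> 1/2, so the
      integrand is at least 1/2.\<close>
    have "0 < (\<integral>\<^sup>+t. ennreal (1 / 2) * indicator {1 / 2..1 :: real} t \<partial>lborel)"
      by (subst nn_integral_cmult_indicator) (simp_all add: ennreal_zero_less_mult_iff ennreal_inverse_positive)
    also have "\<dots> \<le> K" unfolding K_def
    proof (intro nn_integral_mono)
      fix t :: real
      have "1 / 2 \<le> G 1 t" if "t \<in> {1 / 2..1}"
      proof -
        have "1 \<le> t powr (s - 1)" using that s powr_mono2'[of "s - 1" t 1] by simp
        then have "1 * (1 / 2) \<le> t powr (s - 1) * (1 / (1 + t))"
          using that by (intro mult_mono) (auto simp: field_simps)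
        then show ?thesis using that by (simp add: G_def)
      qed
      then show "ennreal (1 / 2) * indicator {1 / 2..1} t \<le> ennreal (G 1 t)"
        using ennreal_leI[of "1 / 2" "G 1 t"] by (cases "t \<in> {1 / 2..1}") simp_all
    qed
    finally show ?thesis .
  qed
  ultimately obtain k where k: "K = ennreal k" "0 < k"
    by (cases K) auto
  have "(\<integral>\<^sup>+t. ennreal (G x t) \<partial>lborel) = ennreal (x powr s * k)" if x: "0 \<le> x" for x
  proof (cases "x = 0")
    case True
    then show ?thesis by (simp add: G_def cong: if_cong)
  next
    case False
    with x have x: "0 < x" by simp
    \<comment> \<open>The summand 0 matches the shape of the affine change of variables in
      \<open>nn_integral_real_affine\<close>.\<close>
    have G: "G x (0 + x * u) = x powr (s - 1) * G 1 u" for u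
    proof (cases "0 < u")
      case True
      have "x + x * u = x * (1 + u)" by (simp add: algebra_simps)
      then have "x / (x + x * u) = 1 / (1 + u)" using x by simp
      then show ?thesis using True x by (simp add: G_def powr_mult)
    next
      case False
      then show ?thesis using x by (simp add: G_def zero_less_mult_iff)
    qed
    have "(\<integral>\<^sup>+t. ennreal (G x t) \<partial>lborel) = ennreal \<bar>x\<bar> * (\<integral>\<^sup>+u. ennreal (G x (0 + x * u)) \<partial>lborel)"
      using x by (intro nn_integral_real_affine) auto
    also have "(\<integral>\<^sup>+u. ennreal (G x (0 + x * u)) \<partial>lborel) = (\<integral>\<^sup>+u. ennreal (x powr (s - 1)) * ennreal (G 1 u) \<partial>lborel)"
      unfolding G by (intro nn_integral_cong) (simp add: ennreal_mult' G_def)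
    also have "\<dots> = ennreal (x powr (s - 1)) * K" unfolding K_def by (rule nn_integral_cmult) simp
    also have "ennreal \<bar>x\<bar> * \<dots> = ennreal (x * x powr (s - 1) * k)"
      using x k by (simp add: ennreal_mult[symmetric] mult.assoc)
    also have "x * x powr (s - 1) = x powr s" using x powr_add[of x 1 "s - 1"] by simp
    finally show ?thesis .
  qed
  with k(2) that show ?thesis by blast
qed

text \<open>The two sums stand for quadratic forms of two operators, each in its own eigenbasis, so
  nothing relates \<open>d i\<close> to \<open>e i\<close> individually. Integrating the comparison
  at each t against t^(s-1) turns it into one for powers.\<close>

lemma sum_powr_mono:
  fixes w d v e :: "'a \<Rightarrow> real"
  assumes s: "0 < s" "s < 1"
    and nonneg: "\<And>i. i \<in> I \<Longrightarrow> 0 \<le> w i \<and> 0 \<le> d i" "\<And>i. i \<in> I \<Longrightarrow> 0 \<le> v i \<and> 0 \<le> e i"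
    and le: "\<And>t. 0 < t \<Longrightarrow> (\<Sum>i\<in>I. w i * (d i / (d i + t))) \<le> (\<Sum>i\<in>I. v i * (e i / (e i + t)))"
  shows "(\<Sum>i\<in>I. w i * d i powr s) \<le> (\<Sum>i\<in>I. v i * e i powr s)"
proof -
  define G :: "real \<Rightarrow> real \<Rightarrow> real"
    where "G \<equiv> \<lambda>x t. if 0 < t then t powr (s - 1) * (x / (x + t)) else 0"
  obtain k where k: "0 < k" "\<And>x. 0 \<le> x \<Longrightarrow> (\<integral>\<^sup>+t. ennreal (G x t) \<partial>lborel) = ennreal (x powr s * k)"
    using powr_integral_representation[OF s] unfolding G_def by blast
  have meas [measurable]: "G x \<in> borel_measurable borel" for x
    unfolding G_def by measurable
  have G0: "0 \<le> x \<Longrightarrow> 0 \<le> G x t" for x t by (simp add: G_def)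
  have int: "(\<integral>\<^sup>+t. ennreal (\<Sum>i\<in>I. w i * G (d i) t) \<partial>lborel) = ennreal ((\<Sum>i\<in>I. w i * d i powr s) * k)"
    if *: "\<And>i. i \<in> I \<Longrightarrow> 0 \<le> w i \<and> 0 \<le> d i" for w d :: "'a \<Rightarrow> real"
  proof -
    have "(\<integral>\<^sup>+t. ennreal (\<Sum>i\<in>I. w i * G (d i) t) \<partial>lborel)
        = (\<integral>\<^sup>+t. (\<Sum>i\<in>I. ennreal (w i) * ennreal (G (d i) t)) \<partial>lborel)"
      using * G0 by (intro nn_integral_cong) (auto simp: sum_ennreal[symmetric] ennreal_mult' intro!: sum.cong)
    also have "\<dots> = (\<Sum>i\<in>I. ennreal (w i) * (\<integral>\<^sup>+t. ennreal (G (d i) t) \<partial>lborel))"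
      by (subst nn_integral_sum) (auto intro!: sum.cong nn_integral_cmult)
    also have "\<dots> = (\<Sum>i\<in>I. ennreal (w i * d i powr s * k))"
      using * k by (intro sum.cong) (auto simp: ennreal_mult[symmetric] mult.assoc)
    also have "\<dots> = ennreal (\<Sum>i\<in>I. w i * d i powr s * k)"
      using * k by (intro sum_ennreal) simp
    finally show ?thesis by (simp add: sum_distrib_right)
  qed
  have "(\<integral>\<^sup>+t. ennreal (\<Sum>i\<in>I. w i * G (d i) t) \<partial>lborel) \<le> (\<integral>\<^sup>+t. ennreal (\<Sum>i\<in>I. v i * G (e i) t) \<partial>lborel)"
  proof (intro nn_integral_mono ennreal_leI)
    fix t :: real
    show "(\<Sum>i\<in>I. w i * G (d i) t) \<le> (\<Sum>i\<in>I. v i * G (e i) t)"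
    proof (cases "0 < t")
      case True
      have "t powr (s - 1) * (\<Sum>i\<in>I. w i * (d i / (d i + t))) \<le> t powr (s - 1) * (\<Sum>i\<in>I. v i * (e i / (e i + t)))"
        using le[OF True] by (intro mult_left_mono) auto
      then show ?thesis using True by (simp add: G_def sum_distrib_left mult_ac)
    qed (simp add: G_def)
  qed
  then have "ennreal ((\<Sum>i\<in>I. w i * d i powr s) * k) \<le> ennreal ((\<Sum>i\<in>I. v i * e i powr s) * k)"
    by (subst (asm) int, use nonneg(1) in blast, subst (asm) int, use nonneg(2) in blast)
  moreover have "0 \<le> (\<Sum>i\<in>I. v i * e i powr s) * k" using nonneg k by (auto intro!: mult_nonneg_nonneg sum_nonneg)
  ultimately show ?thesis using k by simp
qed

text \<open>The resolvent comparison uses the variational formula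
  \<open>\<langle>f, (A + t)\<^sup>-\<^sup>1 f\<rangle> = max\<^sub>g (2 Re \<langle>g, f\<rangle> - \<langle>g, (A + t) g\<rangle>)\<close>, tested at \<open>g = (C + t)\<^sup>-\<^sup>1 f\<close>.\<close>

lemma psd_mat_powr_mono:
  assumes A: "psd n A" and C: "psd n C" and AC: "psd n (C - A)" and s: "0 < s" "s < 1"
  shows "psd n (mat_powr C s - mat_powr A s)"
proof -
  obtain U d where U: "unitary n U" "A = spectral_form n U d" "\<And>k. k < n \<Longrightarrow> 0 \<le> d k"
    using psd_spectral[OF A] by blast
  obtain V e where V: "unitary n V" "C = spectral_form n V e" "\<And>k. k < n \<Longrightarrow> 0 \<le> e k"
    using psd_spectral[OF C] by blast
  note Uc = unitary_carrier[OF U(1)] and Vc = unitary_carrier[OF V(1)]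
  have le: "(\<Sum>k<n. (cmod (coord n U f k))\<^sup>2 * d k powr s) \<le> (\<Sum>k<n. (cmod (coord n V f k))\<^sup>2 * e k powr s)" for f
  proof (rule sum_powr_mono[OF s])
    fix t :: real assume t: "0 < t"
    define a where "a = coord n U f"
    define c where "c = coord n V f"
    define g where "g i = (\<Sum>l<n. V $$ (i, l) * (c l / (e l + t)))" for i
    define b where "b = coord n U g"
    \<comment> \<open>The value of the resolvent form <f, (C + t)^(-1) f>.\<close>
    define R where "R = (\<Sum>k<n. (cmod (c k))\<^sup>2 / (e k + t))"
    have Vg: "coord n V g k = c k / (e k + t)" if k: "k < n" for k
    proof -
      have "coord n V g k = (\<Sum>l<n. (\<Sum>i<n. cnj (V $$ (i, k)) * V $$ (i, l)) * (c l / (e l + t)))"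
        by (simp add: coord_def g_def sum_distrib_left sum_distrib_right mult_ac) (rule sum.swap)
      also have "\<dots> = (\<Sum>l<n. if l = k then c l / (e l + t) else 0)"
        using k by (intro sum.cong) (auto simp: unitary_cols[OF V(1)])
      finally show ?thesis using k by simp
    qed
    have pars: "(\<Sum>k<n. (cmod (coord n U h k))\<^sup>2) = (\<Sum>k<n. (cmod (coord n V h k))\<^sup>2)" for h
    proof -
      have "complex_of_real (\<Sum>k<n. (cmod (coord n U h k))\<^sup>2) = complex_of_real (\<Sum>k<n. (cmod (coord n V h k))\<^sup>2)"
        using coord_parseval[OF U(1), of h h] coord_parseval[OF V(1), of h h]
        by (simp add: complex_norm_square[symmetric] mult.commute[of "cnj _"])
      then show ?thesis by (simp only: of_real_eq_iff)
    qed
    have "qform n C g - qform n A g = qform n (C - A) g"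
      using psd_carrier[OF A] psd_carrier[OF C] by (simp add: qform_minus)
    then have "0 \<le> qform n C g - qform n A g" using AC by (simp add: psd_iff_qform)
    moreover have "qform n C g - qform n A g
        = complex_of_real ((\<Sum>k<n. e k * (cmod (coord n V g k))\<^sup>2) - (\<Sum>k<n. d k * (cmod (coord n U g k))\<^sup>2))"
      unfolding U(2) V(2) qform_spectral_form[OF Uc] qform_spectral_form[OF Vc] by simp
    ultimately have "(\<Sum>k<n. d k * (cmod (b k))\<^sup>2) \<le> (\<Sum>k<n. e k * (cmod (coord n V g k))\<^sup>2)"
      unfolding b_def by (simp add: less_eq_complex_def del: of_real_diff)
    moreover have "(\<Sum>k<n. (cmod (b k))\<^sup>2) = (\<Sum>k<n. (cmod (coord n V g k))\<^sup>2)"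
      unfolding b_def by (rule pars)
    \<comment> \<open>Parseval makes the terms with t equal, so <g, (A + t) g> is at most <g, (C +
      t) g>, which is R.\<close>
    ultimately have "(\<Sum>k<n. (d k + t) * (cmod (b k))\<^sup>2) \<le> (\<Sum>k<n. (e k + t) * (cmod (coord n V g k))\<^sup>2)"
      by (simp add: distrib_right sum.distrib sum_distrib_left[symmetric])
    also have "\<dots> = R" unfolding R_def
    proof (rule sum.cong)
      fix k assume "k \<in> {..<n}"
      then have k: "k < n" by simp
      then have p: "0 < e k + t" using V(3)[OF k] t by simp
      have "(cmod (coord n V g k))\<^sup>2 = (cmod (c k))\<^sup>2 / (e k + t)\<^sup>2"
        unfolding Vg[OF k] using p by (simp add: norm_divide power_divide flip: of_real_add)
      then show "(e k + t) * (cmod (coord n V g k))\<^sup>2 = (cmod (c k))\<^sup>2 / (e k + t)"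
        using p by (simp add: power2_eq_square)
    qed simp
    finally have b1: "(\<Sum>k<n. (d k + t) * (cmod (b k))\<^sup>2) \<le> R" .
    have "(\<Sum>k<n. cnj (b k) * a k) = (\<Sum>k<n. cnj (coord n V g k) * c k)"
      unfolding a_def b_def c_def
      using coord_parseval[OF U(1), of g f] coord_parseval[OF V(1), of g f] by simp
    also have "\<dots> = complex_of_real R"
      unfolding R_def of_real_sum
    proof (rule sum.cong)
      fix k assume "k \<in> {..<n}"
      then have k: "k < n" by simp
      show "cnj (coord n V g k) * c k = complex_of_real ((cmod (c k))\<^sup>2 / (e k + t))"
        unfolding Vg[OF k] by (simp add: complex_norm_square[symmetric] mult.commute[of "cnj _"] flip: of_real_add)
    qed simp
    finally have b2: "(\<Sum>k<n. Re (cnj (b k) * a k)) = R"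
      by (metis Re_complex_of_real Re_sum)
    \<comment> \<open>Since <g, f> is R as well, the variational expression for \<open>A\<close> at
      g is at least 2R - R.\<close>
    have "R = 2 * (\<Sum>k<n. Re (cnj (b k) * a k)) - R" using b2 by simp
    also have "\<dots> \<le> 2 * (\<Sum>k<n. Re (cnj (b k) * a k)) - (\<Sum>k<n. (d k + t) * (cmod (b k))\<^sup>2)" using b1 by simp
    also have "\<dots> = (\<Sum>k<n. 2 * Re (cnj (b k) * a k) - (d k + t) * (cmod (b k))\<^sup>2)"
      by (simp add: sum_subtractf sum_distrib_left)
    \<comment> \<open>The bound by the maximum over g, taken coordinate by coordinate through
      completing the square.\<close>
    also have "\<dots> \<le> (\<Sum>k<n. (cmod (a k))\<^sup>2 / (d k + t))"
    proof (rule sum_mono)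
      fix k assume "k \<in> {..<n}"
      then have p: "0 < d k + t" using U(3)[of k] t by simp
      have "Re (cnj (b k) * a k) \<le> cmod (b k) * cmod (a k)"
        by (metis complex_Re_le_cmod complex_mod_cnj norm_mult)
      moreover have "0 \<le> (cmod (a k) - (d k + t) * cmod (b k))\<^sup>2 / (d k + t)" using p by simp
      then have "0 \<le> (cmod (a k))\<^sup>2 / (d k + t) - 2 * (cmod (b k) * cmod (a k)) + (d k + t) * (cmod (b k))\<^sup>2"
        using p by (simp add: power2_eq_square field_simps)
      ultimately show "2 * Re (cnj (b k) * a k) - (d k + t) * (cmod (b k))\<^sup>2 \<le> (cmod (a k))\<^sup>2 / (d k + t)"
        by linarith
    qed
    finally have res: "(\<Sum>k<n. (cmod (c k))\<^sup>2 / (e k + t)) \<le> (\<Sum>k<n. (cmod (a k))\<^sup>2 / (d k + t))"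
      unfolding R_def .
    \<comment> \<open>Writing x/(x+t) as 1 - t/(x+t) turns the reversed order of the resolvents into
      the wanted one; the total weights agree by Parseval.\<close>
    have split: "(\<Sum>k<n. w k * (x k / (x k + t))) = (\<Sum>k<n. w k) - t * (\<Sum>k<n. w k / (x k + t))"
      if "\<And>k. k < n \<Longrightarrow> 0 \<le> x k" for w x :: "nat \<Rightarrow> real"
      unfolding sum_distrib_left sum_subtractf[symmetric]
    proof (rule sum.cong)
      fix k assume "k \<in> {..<n}"
      then have "0 < x k + t" using that t by (simp add: add_nonneg_pos)
      then show "w k * (x k / (x k + t)) = w k - t * (w k / (x k + t))" by (simp add: field_simps)
    qed simp
    show "(\<Sum>k<n. (cmod (coord n U f k))\<^sup>2 * (d k / (d k + t))) \<le> (\<Sum>k<n. (cmod (coord n V f k))\<^sup>2 * (e k / (e k + t)))"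
      using split[of d "\<lambda>k. (cmod (coord n U f k))\<^sup>2"] split[of e "\<lambda>k. (cmod (coord n V f k))\<^sup>2"]
        U(3) V(3) res pars[of f] t unfolding a_def c_def by simp
  qed (use U(3) V(3) in auto)
  have "qform n (mat_powr C s - mat_powr A s) f
      = complex_of_real ((\<Sum>k<n. e k powr s * (cmod (coord n V f k))\<^sup>2) - (\<Sum>k<n. d k powr s * (cmod (coord n U f k))\<^sup>2))" for f
    unfolding U(2) V(2) qform_minus[OF spectral_form_carrier[OF Vc] spectral_form_carrier[OF Uc]]
      mat_powr_spectral_form[OF U(1)] mat_powr_spectral_form[OF V(1)]
      qform_spectral_form[OF Uc] qform_spectral_form[OF Vc] by simp
  moreover have "mat_powr C s - mat_powr A s \<in> carrier_mat n n"
    by (intro minus_carrier_mat mat_powr_carrier A)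
  ultimately show ?thesis
    using le unfolding psd_iff_qform by (simp add: less_eq_complex_def mult.commute del: of_real_diff)
qed

section \<open>Trace calculus and the optimal test\<close>

lemma mat_trace_add: "A \<in> carrier_mat n n \<Longrightarrow> B \<in> carrier_mat n n \<Longrightarrow> mat_trace (A + B) = mat_trace A + mat_trace B"
  by (simp add: mat_trace_def sum.distrib)

lemma mat_trace_minus: "A \<in> carrier_mat n n \<Longrightarrow> B \<in> carrier_mat n n \<Longrightarrow> mat_trace (A - B) = mat_trace A - mat_trace B"
  by (simp add: mat_trace_def sum_subtractf)

lemma spectral_form_add:
  "U \<in> carrier_mat n n \<Longrightarrow> spectral_form n U d + spectral_form n U e = spectral_form n U (\<lambda>i. d i + e i)"
  using spectral_form_carrier[of U n d] spectral_form_carrier[of U n e] spectral_form_carrier[of U n "\<lambda>i. d i + e i"]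
  by (intro eq_matI) (simp_all add: carrier_matD spectral_form_index algebra_simps sum.distrib)

lemma spectral_form_one: "unitary n U \<Longrightarrow> spectral_form n U (\<lambda>i. 1) = 1\<^sub>m n"
  using spectral_form_carrier[OF unitary_carrier, of n U "\<lambda>i. 1"]
  by (intro eq_matI) (simp_all add: carrier_matD spectral_form_index unitary_carrier unitary_rows)

text \<open>Ozawa's argument: \<open>C = B + (A - B)\<^sub>+ = A + (A - B)\<^sub>-\<close> dominates both \<open>A\<close> and \<open>B\<close>, and the three
  inequalities \<open>Tr A\<^sup>s (C\<^sup>1\<^sup>-\<^sup>s - A\<^sup>1\<^sup>-\<^sup>s) \<ge> 0\<close>, \<open>Tr (C\<^sup>s - A\<^sup>s)(C\<^sup>1\<^sup>-\<^sup>s - B\<^sup>1\<^sup>-\<^sup>s) \<ge> 0\<close> and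
  \<open>Tr (C\<^sup>s - B\<^sup>s) B\<^sup>1\<^sup>-\<^sup>s \<ge> 0\<close> sum up to \<open>Tr A - Tr (A - B)\<^sub>+ \<le> Tr A\<^sup>s B\<^sup>1\<^sup>-\<^sup>s\<close>.\<close>

lemma audenaert_test:
  assumes A: "psd n A" and B: "psd n B" and s: "0 < s" "s < 1"
  shows "\<exists>T. effect n T \<and> Re (mat_trace ((1\<^sub>m n - T) * A)) + Re (mat_trace (T * B))
     \<le> Re (mat_trace (mat_powr A s * mat_powr B (1 - s)))"
proof -
  note Ac = psd_carrier[OF A] and Bc = psd_carrier[OF B]
  have AB: "A - B \<in> carrier_mat n n" by (rule minus_carrier_mat[OF Bc])
  have "hermitian n (A - B)" unfolding hermitian_def
  proof (intro conjI AB allI impI)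
    fix i j assume ij: "i < n" "j < n"
    have "(A - B) $$ (j, i) = A $$ (j, i) - B $$ (j, i)" using Ac Bc ij by simp
    also have "\<dots> = cnj (A $$ (i, j)) - cnj (B $$ (i, j))"
      using psd_hermitian[OF A ij] psd_hermitian[OF B ij] by presburger
    also have "\<dots> = cnj ((A - B) $$ (i, j))" using Ac Bc ij by simp
    finally show "(A - B) $$ (j, i) = cnj ((A - B) $$ (i, j))" .
  qed
  then obtain U d where U: "unitary n U" and H: "A - B = spectral_form n U d" using hermitian_spectral by blast
  note Uc = unitary_carrier[OF U]
  \<comment> \<open>The Helstrom test: the spectral projection onto the positive eigenvalues of
    \<open>A - B\<close>. Its complement is \<open>T'\<close>.\<close>
  define T where "T = spectral_form n U (\<lambda>i. if 0 < d i then 1 else 0)"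
  define T' where "T' = spectral_form n U (\<lambda>i. if 0 < d i then 0 else 1)"
  define P where "P = spectral_form n U (\<lambda>i. max (d i) 0)"
  define N where "N = spectral_form n U (\<lambda>i. max (- d i) 0)"
  note c = spectral_form_carrier[OF Uc]
  have carr: "T \<in> carrier_mat n n" "T' \<in> carrier_mat n n" "P \<in> carrier_mat n n" "N \<in> carrier_mat n n"
    unfolding T_def T'_def P_def N_def by (intro c)+
  have "T + T' = 1\<^sub>m n"
    unfolding T_def T'_def spectral_form_add[OF Uc] spectral_form_one[OF U, symmetric]
    by (intro spectral_form_cong[OF Uc]) simp
  moreover have "(T + T') - T = T'" using carr(1,2) by (intro eq_matI) auto
  ultimately have T': "1\<^sub>m n - T = T'" by simp
  have eff: "effect n T"
    unfolding effect_def T' unfolding T_def T'_def by (intro conjI psd_spectral_form[OF Uc]) auto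
  have P: "psd n P" and N: "psd n N"
    unfolding P_def N_def by (intro psd_spectral_form[OF Uc]; simp)+
  have HN: "(A - B) + N = P"
    unfolding H P_def N_def spectral_form_add[OF Uc] by (intro spectral_form_cong[OF Uc]) simp
  have TH: "T * (A - B) = P"
    unfolding H P_def T_def spectral_form_mult[OF U] by (intro spectral_form_cong[OF Uc]) simp
  define C where "C = B + P"
  have Cc: "C \<in> carrier_mat n n" using Bc carr by (simp add: C_def)
  have CA: "C - A = N" unfolding C_def HN[symmetric] using Ac Bc carr by (intro eq_matI) auto
  have CB: "C - B = P" unfolding C_def using Bc carr by (intro eq_matI) auto
  have C: "psd n C" unfolding C_def by (intro psd_add B P)
  define As where "As = mat_powr A s"
  define Bs where "Bs = mat_powr B s"
  define Cs where "Cs = mat_powr C s"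
  define Ar where "Ar = mat_powr A (1 - s)"
  define Br where "Br = mat_powr B (1 - s)"
  define Cr where "Cr = mat_powr C (1 - s)"
  have car: "As \<in> carrier_mat n n" "Bs \<in> carrier_mat n n" "Cs \<in> carrier_mat n n"
    "Ar \<in> carrier_mat n n" "Br \<in> carrier_mat n n" "Cr \<in> carrier_mat n n"
    unfolding As_def Bs_def Cs_def Ar_def Br_def Cr_def using A B C by (simp_all add: mat_powr_carrier)
  have mult: "As * Ar = A" "Bs * Br = B" "Cs * Cr = C"
    unfolding As_def Bs_def Cs_def Ar_def Br_def Cr_def using A B C by (simp_all add: mat_powr_mult)
  \<comment> \<open>Monotonicity enters with both exponents, s and 1 - s.\<close>
  have s': "0 < 1 - s" "1 - s < 1" using s by auto
  have 1: "0 \<le> Re (mat_trace (As * (Cr - Ar)))"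
    unfolding As_def Cr_def Ar_def
    by (rule psd_trace_mult_nonneg[OF psd_mat_powr[OF A] psd_mat_powr_mono[OF A C _ s']]) (simp add: CA N)
  have 2: "0 \<le> Re (mat_trace ((Cs - As) * (Cr - Br)))"
    unfolding As_def Cs_def Cr_def Br_def
    by (rule psd_trace_mult_nonneg[OF psd_mat_powr_mono[OF A C _ s] psd_mat_powr_mono[OF B C _ s']])
      (simp_all add: CA CB N P)
  have 3: "0 \<le> Re (mat_trace ((Cs - Bs) * Br))"
    unfolding Cs_def Bs_def Br_def
    by (rule psd_trace_mult_nonneg[OF psd_mat_powr_mono[OF B C _ s] psd_mat_powr[OF B]]) (simp add: CB P)
  \<comment> \<open>In the sum of the three inequalities Tr A^s C^(1-s) and Tr C^s B^(1-s) cancel,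
    which leaves a bound on Tr A - Tr P, the error sum of \<open>T\<close>.\<close>
  have e1: "mat_trace (As * (Cr - Ar)) = mat_trace (As * Cr) - mat_trace A"
    using car mult Ac by (simp add: mult_minus_distrib_mat[of _ n n _ n] mat_trace_minus[of _ n])
  have e2: "mat_trace ((Cs - As) * (Cr - Br))
      = (mat_trace C - mat_trace (Cs * Br)) - (mat_trace (As * Cr) - mat_trace (As * Br))"
    using car mult Cc by (simp add: minus_carrier_mat mult_minus_distrib_mat[of _ n n _ n] minus_mult_distrib_mat[of _ n n _ _ n] mat_trace_minus[of _ n])
  have e3: "mat_trace ((Cs - Bs) * Br) = mat_trace (Cs * Br) - mat_trace B"
    using car mult Bc by (simp add: minus_mult_distrib_mat[of _ n n _ _ n] mat_trace_minus[of _ n])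
  have eC: "mat_trace C = mat_trace B + mat_trace P"
    unfolding C_def using Bc carr by (intro mat_trace_add)
  have "mat_trace ((1\<^sub>m n - T) * A) = mat_trace A - mat_trace (T * A)"
    using Ac carr by (simp add: minus_mult_distrib_mat[of _ n n _ _ n] mat_trace_minus[of _ n])
  moreover have "mat_trace P = mat_trace (T * A) - mat_trace (T * B)"
    unfolding TH[symmetric] using Ac Bc carr
    by (simp add: mult_minus_distrib_mat[of _ n n _ n] mat_trace_minus[of _ n])
  ultimately have "Re (mat_trace ((1\<^sub>m n - T) * A)) + Re (mat_trace (T * B)) \<le> Re (mat_trace (As * Br))"
    using 1 2 3 unfolding e1 e2 e3 eC by simp
  then show ?thesis using eff unfolding As_def Br_def by blast
qed

subsection \<open>Kronecker products\<close>

lemma add_mult_less: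
  fixes i k n m :: nat
  assumes "i < n" "k < m"
  shows "i * m + k < n * m"
proof -
  have "i * m + k < Suc i * m" using assms by simp
  also have "\<dots> \<le> n * m" using assms by (intro mult_right_mono) auto
  finally show ?thesis .
qed

lemma div_mod_less:
  fixes p n m :: nat
  assumes "p < n * m"
  shows "p div m < n" "p mod m < m"
proof -
  have "0 < m" using assms by (cases m) auto
  then show "p div m < n" "p mod m < m" using assms by (simp_all add: less_mult_imp_div_less)
qed

text \<open>The bijection behind the index convention of \<open>kron\<close>: it turns a sum over
  tensor indices into a double sum that can factor.\<close>

lemma sum_div_mod:
  "(\<Sum>p<n * m. f (p div m) (p mod m)) = (\<Sum>i<n. \<Sum>j<m. f i j)" for n m :: nat
proof -
  have "(\<Sum>p<n * m. f (p div m) (p mod m)) = (\<Sum>(i, j)\<in>{..<n} \<times> {..<m}. f i j)"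
    by (rule sum.reindex_bij_witness[where i = "\<lambda>(i, j). i * m + j" and j = "\<lambda>p. (p div m, p mod m)"])
      (auto simp: div_mod_less add_mult_less)
  then show ?thesis by (simp add: sum.cartesian_product)
qed

lemma kron_dim [simp]: "dim_row (kron A B) = dim_row A * dim_row B" "dim_col (kron A B) = dim_col A * dim_col B"
  by (simp_all add: kron_def)

lemma kron_carrier:
  "A \<in> carrier_mat n m \<Longrightarrow> B \<in> carrier_mat k l \<Longrightarrow> kron A B \<in> carrier_mat (n * k) (m * l)"
  by (intro carrier_matI) auto

lemma kron_index:
  assumes "A \<in> carrier_mat n m" "B \<in> carrier_mat k l" "p < n * k" "q < m * l"
  shows "kron A B $$ (p, q) = A $$ (p div k, q div l) * B $$ (p mod k, q mod l)"
  using assms by (simp add: kron_def)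

lemma kron_mult:
  assumes A: "A \<in> carrier_mat n m" and B: "B \<in> carrier_mat k l"
    and C: "C \<in> carrier_mat m m'" and D: "D \<in> carrier_mat l l'"
  shows "kron A B * kron C D = kron (A * C) (B * D)"
proof (rule eq_matI)
  fix p q assume "p < dim_row (kron (A * C) (B * D))" "q < dim_col (kron (A * C) (B * D))"
  then have pq: "p < n * k" "q < m' * l'" using assms by auto
  have AC: "A * C \<in> carrier_mat n m'" and BD: "B * D \<in> carrier_mat k l'" using assms by auto
  note d = div_mod_less[OF pq(1)] div_mod_less[OF pq(2)]
  have "(kron A B * kron C D) $$ (p, q) = (\<Sum>r<m * l. kron A B $$ (p, r) * kron C D $$ (r, q))"
    by (rule mult_mat_index[OF kron_carrier[OF A B] kron_carrier[OF C D] pq])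
  also have "\<dots> = (\<Sum>r<m * l. (A $$ (p div k, r div l) * C $$ (r div l, q div l'))
      * (B $$ (p mod k, r mod l) * D $$ (r mod l, q mod l')))"
    using pq by (intro sum.cong) (simp_all add: kron_index[OF A B] kron_index[OF C D])
  also have "\<dots> = (\<Sum>i<m. A $$ (p div k, i) * C $$ (i, q div l')) * (\<Sum>j<l. B $$ (p mod k, j) * D $$ (j, q mod l'))"
    unfolding sum_product by (rule sum_div_mod)
  also have "\<dots> = kron (A * C) (B * D) $$ (p, q)"
    using d pq by (simp add: kron_index[OF AC BD] mult_mat_index[OF A C] mult_mat_index[OF B D] del: index_mult_mat)
  finally show "(kron A B * kron C D) $$ (p, q) = kron (A * C) (B * D) $$ (p, q)" .
qed (use assms in auto)

lemma mat_trace_kron: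
  assumes "A \<in> carrier_mat n n" "B \<in> carrier_mat m m"
  shows "mat_trace (kron A B) = mat_trace A * mat_trace B"
  using assms sum_div_mod[of "\<lambda>i j. A $$ (i, i) * B $$ (j, j)" m n]
  by (simp add: mat_trace_def sum_product kron_index[OF assms])

lemma mat_adjoint_kron:
  assumes A: "A \<in> carrier_mat n m" and B: "B \<in> carrier_mat k l"
  shows "mat_adjoint (kron A B) = kron (mat_adjoint A) (mat_adjoint B)"
proof (rule eq_matI)
  fix p q assume "p < dim_row (kron (mat_adjoint A) (mat_adjoint B))" "q < dim_col (kron (mat_adjoint A) (mat_adjoint B))"
  then have pq: "p < m * l" "q < n * k" using assms by auto
  note d = div_mod_less[OF pq(1)] div_mod_less[OF pq(2)]
  have "mat_adjoint (kron A B) $$ (p, q) = cnj (kron A B $$ (q, p))"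
    using assms pq by (intro mat_adjoint_index) auto
  then show "mat_adjoint (kron A B) $$ (p, q) = kron (mat_adjoint A) (mat_adjoint B) $$ (p, q)"
    using pq d A B
    by (simp add: kron_index[OF A B] kron_index[OF mat_adjoint_carrier[OF A] mat_adjoint_carrier[OF B]] mat_adjoint_index)
qed (use assms in auto)

lemma kron_mat_diag:
  "kron (mat_diag n f) (mat_diag m g) = mat_diag (n * m) (\<lambda>p. f (p div m) * g (p mod m))"
proof (rule eq_matI)
  fix p q assume "p < dim_row (mat_diag (n * m) (\<lambda>p. f (p div m) * g (p mod m)))"
    "q < dim_col (mat_diag (n * m) (\<lambda>p. f (p div m) * g (p mod m)))"
  then have pq: "p < n * m" "q < n * m" by (auto simp: mat_diag_def)
  have "p = q \<longleftrightarrow> p div m = q div m \<and> p mod m = q mod m" by (metis div_mult_mod_eq)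
  then show "kron (mat_diag n f) (mat_diag m g) $$ (p, q) = mat_diag (n * m) (\<lambda>p. f (p div m) * g (p mod m)) $$ (p, q)"
    using pq div_mod_less[OF pq(1)] div_mod_less[OF pq(2)]
    by (auto simp: kron_def mat_diag_def)
qed (simp_all add: mat_diag_def)

lemma kron_one: "kron (1\<^sub>m n) (1\<^sub>m m) = 1\<^sub>m (n * m)"
  using kron_mat_diag[of n "\<lambda>_. 1" m "\<lambda>_. 1"] by simp

lemma unitary_kron:
  assumes U: "unitary n U" and V: "unitary m V"
  shows "unitary (n * m) (kron U V)"
proof -
  have c: "U \<in> carrier_mat n n" "V \<in> carrier_mat m m" "mat_adjoint U \<in> carrier_mat n n" "mat_adjoint V \<in> carrier_mat m m"
    using U V by (auto simp: unitary_def intro!: mat_adjoint_carrier)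
  show ?thesis
    using U V kron_carrier[OF c(1,2)] unfolding unitary_def mat_adjoint_kron[OF c(1,2)]
    by (simp add: kron_mult[OF c(1,2,3,4)] kron_mult[OF c(3,4,1,2)] kron_one)
qed

lemma kron_spectral_form:
  assumes U: "U \<in> carrier_mat n n" and V: "V \<in> carrier_mat m m"
  shows "kron (spectral_form n U d) (spectral_form m V e)
    = spectral_form (n * m) (kron U V) (\<lambda>p. d (p div m) * e (p mod m))"
proof -
  have D: "mat_diag n (\<lambda>i. complex_of_real (d i)) \<in> carrier_mat n n"
    and E: "mat_diag m (\<lambda>i. complex_of_real (e i)) \<in> carrier_mat m m" by simp_all
  have UD: "U * mat_diag n (\<lambda>i. complex_of_real (d i)) \<in> carrier_mat n n"
    and VE: "V * mat_diag m (\<lambda>i. complex_of_real (e i)) \<in> carrier_mat m m" using U V D E by simp_all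
  show ?thesis
    unfolding spectral_form_def mat_adjoint_kron[OF U V] kron_mult[OF UD VE mat_adjoint_carrier[OF U] mat_adjoint_carrier[OF V], symmetric]
      kron_mult[OF U V D E, symmetric] kron_mat_diag by simp
qed

lemma psd_kron:
  assumes "psd n A" "psd m B"
  shows "psd (n * m) (kron A B)"
proof -
  obtain U d where U: "unitary n U" "A = spectral_form n U d" "\<And>k. k < n \<Longrightarrow> 0 \<le> d k"
    using psd_spectral[OF assms(1)] by blast
  obtain V e where V: "unitary m V" "B = spectral_form m V e" "\<And>k. k < m \<Longrightarrow> 0 \<le> e k"
    using psd_spectral[OF assms(2)] by blast
  show ?thesis
    unfolding U(2) V(2) kron_spectral_form[OF unitary_carrier[OF U(1)] unitary_carrier[OF V(1)]]
    using U(3) V(3) div_mod_less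
    by (intro psd_spectral_form kron_carrier unitary_carrier U(1) V(1)) (metis mult_nonneg_nonneg)
qed

text \<open>The Kronecker product of two eigenbases diagonalizes \<open>kron A B\<close> with
  products as eigenvalues, over which \<open>powr\<close> distributes;
  \<open>mat_powr_spectral_form\<close> permits evaluating the power in this basis.\<close>

lemma mat_powr_kron:
  assumes "psd n A" "psd m B"
  shows "mat_powr (kron A B) s = kron (mat_powr A s) (mat_powr B s)"
proof -
  obtain U d where U: "unitary n U" "A = spectral_form n U d" using psd_spectral[OF assms(1)] by blast
  obtain V e where V: "unitary m V" "B = spectral_form m V e" using psd_spectral[OF assms(2)] by blast
  note k = kron_spectral_form[OF unitary_carrier[OF U(1)] unitary_carrier[OF V(1)]]
  show ?thesis
    unfolding U(2) V(2) k mat_powr_spectral_form[OF U(1)] mat_powr_spectral_form[OF V(1)]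
      mat_powr_spectral_form[OF unitary_kron[OF U(1) V(1)]]
    by (simp add: powr_mult)
qed

lemma mat_powr_smult:
  assumes "psd n A"
  shows "mat_powr (complex_of_real c \<cdot>\<^sub>m A) s = complex_of_real (c powr s) \<cdot>\<^sub>m mat_powr A s"
proof -
  obtain U d where U: "unitary n U" "A = spectral_form n U d" using psd_spectral[OF assms] by blast
  note Uc = unitary_carrier[OF U(1)]
  have *: "complex_of_real c \<cdot>\<^sub>m spectral_form n U d = spectral_form n U (\<lambda>i. c * d i)" for c d
    using spectral_form_carrier[OF Uc, of d] spectral_form_carrier[OF Uc, of "\<lambda>i. c * d i"]
    by (intro eq_matI) (simp_all add: carrier_matD spectral_form_index[OF Uc] sum_distrib_left mult_ac)
  show ?thesis
    unfolding U(2) * mat_powr_spectral_form[OF U(1)] by (simp add: powr_mult)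
qed

lemma density_op_kron: "density_op n \<rho> \<Longrightarrow> density_op m \<sigma> \<Longrightarrow> density_op (n * m) (kron \<rho> \<sigma>)"
  by (auto simp: density_op_def psd_kron mat_trace_kron[OF psd_carrier psd_carrier])

text \<open>\<open>Re\<close> is not multiplicative in general, but Re (z w) = Re z Re w for real z;
  this supplies such a z for the overlaps.\<close>

lemma mat_trace_mult_psd_real:
  assumes A: "psd n A" and B: "psd n B"
  shows "mat_trace (A * B) \<in> \<real>"
proof -
  obtain U d where U: "unitary n U" "B = spectral_form n U d" using psd_spectral[OF B] by blast
  have "qform n A f \<in> \<real>" for f using A by (simp add: psd_iff_qform less_eq_complex_def complex_is_Real_iff)
  then show ?thesis
    unfolding U(2) mat_trace_mult_spectral_form[OF psd_carrier[OF A] unitary_carrier[OF U(1)]]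
    by (auto intro!: sum_in_Reals Reals_mult)
qed

text \<open>The argument of the logarithm in \<open>petz_div\<close>. Bounds on it also make sense
  at overlap 0, where the divergence is infinite.\<close>

definition petz_overlap :: "real \<Rightarrow> complex mat \<Rightarrow> complex mat \<Rightarrow> real" where
  "petz_overlap \<alpha> \<rho> \<sigma> = Re (mat_trace (mat_powr \<rho> \<alpha> * mat_powr \<sigma> (1 - \<alpha>)))"

lemma petz_overlap_nonneg: "psd n \<rho> \<Longrightarrow> psd n \<sigma> \<Longrightarrow> 0 \<le> petz_overlap \<alpha> \<rho> \<sigma>"
  unfolding petz_overlap_def by (intro psd_trace_mult_nonneg psd_mat_powr)

lemma petz_overlap_kron:
  assumes "psd n \<rho>" "psd n \<sigma>" "psd m \<rho>'" "psd m \<sigma>'"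
  shows "petz_overlap \<alpha> (kron \<rho> \<rho>') (kron \<sigma> \<sigma>') = petz_overlap \<alpha> \<rho> \<sigma> * petz_overlap \<alpha> \<rho>' \<sigma>'"
proof -
  have c: "mat_powr \<rho> \<alpha> \<in> carrier_mat n n" "mat_powr \<rho>' \<alpha> \<in> carrier_mat m m"
    "mat_powr \<sigma> (1 - \<alpha>) \<in> carrier_mat n n" "mat_powr \<sigma>' (1 - \<alpha>) \<in> carrier_mat m m"
    using assms by (auto intro: mat_powr_carrier)
  have "mat_trace (mat_powr \<rho> \<alpha> * mat_powr \<sigma> (1 - \<alpha>)) \<in> \<real>"
    using assms by (intro mat_trace_mult_psd_real psd_mat_powr)
  then show ?thesis
    unfolding petz_overlap_def mat_powr_kron[OF assms(1,3)] mat_powr_kron[OF assms(2,4)] kron_mult[OF c]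
    using c by (simp add: mat_trace_kron[of _ n _ m] complex_is_Real_iff)
qed

lemma kron_add_left:
  "A \<in> carrier_mat n m \<Longrightarrow> B \<in> carrier_mat n m \<Longrightarrow> kron (A + B) C = kron A C + kron B C"
  by (intro eq_matI) (auto simp: kron_def div_mod_less algebra_simps)

lemma kron_smult_left: "kron (c \<cdot>\<^sub>m A) B = c \<cdot>\<^sub>m kron A B"
  by (intro eq_matI) (auto simp: kron_def div_mod_less)

text \<open>\<open>map_tensor_power\<close> peels off factors on the left, so splitting a power into
  two blocks has to regroup brackets. On indices this is the arithmetic of iterated
  \<open>div\<close> and \<open>mod\<close>.\<close>

lemma kron_assoc: "kron (kron A B) C = kron A (kron B C)"
proof (rule eq_matI)
  fix p q assume "p < dim_row (kron A (kron B C))" "q < dim_col (kron A (kron B C))"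
  then have pq: "p < dim_row A * dim_row B * dim_row C" "q < dim_col A * dim_col B * dim_col C"
    by (simp_all add: mult.assoc)
  note d = div_mod_less[OF pq(1)] div_mod_less[OF pq(2)]
  have 1: "p div r div k = p div (k * r)" "p div r mod k = p mod (k * r) div r" "p mod (k * r) mod r = p mod r"
    for p k r :: nat
  proof -
    show "p div r div k = p div (k * r)" by (subst mult.commute) (rule div_mult2_eq[symmetric])
    have "p mod (k * r) = r * (p div r mod k) + p mod r" by (subst mult.commute) (rule mod_mult2_eq)
    then show "p div r mod k = p mod (k * r) div r" by (cases "r = 0") auto
    show "p mod (k * r) mod r = p mod r" by (simp add: mod_mod_cancel)
  qed
  have "p mod (dim_row B * dim_row C) < dim_row B * dim_row C" "q mod (dim_col B * dim_col C) < dim_col B * dim_col C"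
    using div_mod_less(2)[of p "dim_row A" "dim_row B * dim_row C"] div_mod_less(2)[of q "dim_col A" "dim_col B * dim_col C"] pq
    by (simp_all add: mult.assoc)
  then show "kron (kron A B) C $$ (p, q) = kron A (kron B C) $$ (p, q)"
    using pq d by (simp add: kron_def 1 mult.assoc)
qed (simp_all add: mult.assoc)

subsection \<open>Kraus forms and tensor powers of channels\<close>

lemma mat_unit_carrier [simp]: "mat_unit n i j \<in> carrier_mat n n"
  by (simp add: mat_unit_def)

lemma kron_mat_unit:
  assumes "p < n * m" "q < n * m"
  shows "mat_unit (n * m) p q = kron (mat_unit n (p div m) (q div m)) (mat_unit m (p mod m) (q mod m))"
proof (rule eq_matI)
  fix i j assume "i < dim_row (kron (mat_unit n (p div m) (q div m)) (mat_unit m (p mod m) (q mod m)))"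
    "j < dim_col (kron (mat_unit n (p div m) (q div m)) (mat_unit m (p mod m) (q mod m)))"
  then have ij: "i < n * m" "j < n * m" by (auto simp: mat_unit_def)
  have "x = y \<longleftrightarrow> x div m = y div m \<and> x mod m = y mod m" for x y by (metis div_mult_mod_eq)
  from this[of i p] this[of j q]
  show "mat_unit (n * m) p q $$ (i, j) = kron (mat_unit n (p div m) (q div m)) (mat_unit m (p mod m) (q mod m)) $$ (i, j)"
    using ij div_mod_less[OF ij(1)] div_mod_less[OF ij(2)]
    by (auto simp: kron_def mat_unit_def)
qed (simp_all add: mat_unit_def)

lemma linear_mat_map_carrier: "linear_mat_map a b \<Phi> \<Longrightarrow> X \<in> carrier_mat a a \<Longrightarrow> \<Phi> X \<in> carrier_mat b b"
  by (simp add: linear_mat_map_def)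

lemma linear_mat_map_eqI:
  assumes F: "linear_mat_map a b F" and G: "linear_mat_map a b G"
    and eq: "\<And>i j. i < a \<Longrightarrow> j < a \<Longrightarrow> F (mat_unit a i j) = G (mat_unit a i j)"
    and X: "X \<in> carrier_mat a a"
  shows "F X = G X"
  using linear_mat_map_carrier[OF F X] linear_mat_map_carrier[OF G X]
  by (intro eq_matI) (auto simp: linear_mat_map_expand[OF F X] linear_mat_map_expand[OF G X] eq)

lemma linear_map_tensor: "linear_mat_map (a1 * a2) (b1 * b2) (map_tensor a1 b1 a2 b2 \<Phi> \<Psi>)"
  unfolding linear_mat_map_def
proof (intro conjI ballI allI)
  fix X Y :: "complex mat" assume "X \<in> carrier_mat (a1 * a2) (a1 * a2)" "Y \<in> carrier_mat (a1 * a2) (a1 * a2)"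
  then show "map_tensor a1 b1 a2 b2 \<Phi> \<Psi> (X + Y) = map_tensor a1 b1 a2 b2 \<Phi> \<Psi> X + map_tensor a1 b1 a2 b2 \<Phi> \<Psi> Y"
    by (intro eq_matI) (simp_all add: map_tensor_def add_mult_less distrib_right sum.distrib)
next
  fix c and X :: "complex mat" assume "X \<in> carrier_mat (a1 * a2) (a1 * a2)"
  then show "map_tensor a1 b1 a2 b2 \<Phi> \<Psi> (c \<cdot>\<^sub>m X) = c \<cdot>\<^sub>m map_tensor a1 b1 a2 b2 \<Phi> \<Psi> X"
    by (intro eq_matI) (simp_all add: map_tensor_def add_mult_less sum_distrib_left mult.assoc)
qed (simp add: map_tensor_def)

lemma map_tensor_mat_unit:
  assumes "linear_mat_map a1 b1 \<Phi>" "linear_mat_map a2 b2 \<Psi>" "i < a1 * a2" "j < a1 * a2"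
  shows "map_tensor a1 b1 a2 b2 \<Phi> \<Psi> (mat_unit (a1 * a2) i j)
    = kron (\<Phi> (mat_unit a1 (i div a2) (j div a2))) (\<Psi> (mat_unit a2 (i mod a2) (j mod a2)))"
  unfolding kron_mat_unit[OF assms(3,4)] using assms(1,2) by (intro map_tensor_kron) simp_all

text \<open>A Kraus decomposition, read off on matrix units: \<open>v r i p\<close> is the \<open>(p, i)\<close> entry of the \<open>r\<close>-th
  Kraus operator.\<close>

definition kraus_map :: "nat \<Rightarrow> nat \<Rightarrow> (complex mat \<Rightarrow> complex mat) \<Rightarrow> nat \<Rightarrow> (nat \<Rightarrow> nat \<Rightarrow> nat \<Rightarrow> complex) \<Rightarrow> bool" where
  "kraus_map a b \<Phi> R v \<longleftrightarrow> (\<forall>i<a. \<forall>j<a. \<forall>p<b. \<forall>q<b.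
     \<Phi> (mat_unit a i j) $$ (p, q) = (\<Sum>r<R. v r i p * cnj (v r j q)))"

text \<open>The class in which the induction over tensor powers runs: a Kraus form passes to
  \<open>map_tensor\<close> directly, unlike the condition in \<open>completely_positive\<close>. By
  linearity it is enough to impose conditions on matrix units.\<close>

definition kraus_channel :: "nat \<Rightarrow> nat \<Rightarrow> (complex mat \<Rightarrow> complex mat) \<Rightarrow> bool" where
  "kraus_channel a b \<Phi> \<longleftrightarrow> linear_mat_map a b \<Phi> \<and> (\<exists>R v. kraus_map a b \<Phi> R v) \<and>
     (\<forall>i<a. \<forall>j<a. mat_trace (\<Phi> (mat_unit a i j)) = (if i = j then 1 else 0))"

lemma kraus_channel_linear: "kraus_channel a b \<Phi> \<Longrightarrow> linear_mat_map a b \<Phi>"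
  by (simp add: kraus_channel_def)

lemma mat_trace_mat_unit: "i < n \<Longrightarrow> j < n \<Longrightarrow> mat_trace (mat_unit n i j) = (if i = j then 1 else 0)"
  by (auto simp: mat_trace_def mat_unit_def)

text \<open>Complete positivity is only used on the unnormalized maximally entangled matrix \<open>X\<close>; the
  eigenvectors of its image, the Choi matrix \<open>Y\<close>, are the Kraus operators.\<close>

lemma completely_positive_kraus:
  assumes lin: "linear_mat_map a b \<Phi>" and cp: "completely_positive a b \<Phi>"
  shows "\<exists>R v. kraus_map a b \<Phi> R v"
proof -
  \<comment> \<open>The vector with entry 1 at the pairs (i, i), so that \<open>X\<close> is the sum
    of all E_ij tensor E_ij.\<close>
  define x :: "nat \<Rightarrow> complex" where "x p = (if p div a = p mod a then 1 else 0)" for p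
  define X where "X = mat (a * a) (a * a) (\<lambda>(p, q). x p * x q)"
  have "psd (a * a) X" unfolding psd_iff_qform
  proof (intro conjI allI)
    fix f
    have "qform (a * a) X f = (\<Sum>p<a * a. \<Sum>q<a * a. (cnj (f p) * x p) * (x q * f q))"
      by (simp add: qform_def X_def mult_ac)
    also have "\<dots> = (\<Sum>p<a * a. cnj (f p) * x p) * (\<Sum>q<a * a. x q * f q)" by (simp add: sum_product)
    also have "(\<Sum>p<a * a. cnj (f p) * x p) = cnj (\<Sum>q<a * a. x q * f q)"
      unfolding cnj_sum by (intro sum.cong) (simp_all add: x_def)
    finally have "qform (a * a) X f = complex_of_real ((cmod (\<Sum>q<a * a. x q * f q))\<^sup>2)"
      by (simp only: complex_norm_square mult.commute)
    then show "0 \<le> qform (a * a) X f" by (simp add: less_eq_complex_def)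
  qed (simp add: X_def)
  define Y where "Y = map_tensor a a a b (\<lambda>Y. Y) \<Phi> X"
  have Y: "psd (a * b) Y" using cp \<open>psd (a * a) X\<close> by (auto simp: completely_positive_def Y_def)
  have lid: "linear_mat_map a a (\<lambda>Y. Y)" by (simp add: linear_mat_map_def)
  have \<Phi>: "\<Phi> (mat_unit a i j) \<in> carrier_mat b b" for i j by (rule linear_mat_map_carrier[OF lin]) simp
  \<comment> \<open>Block (i, j) of the Choi matrix is the image of the matrix unit E_ij.\<close>
  have YE: "Y $$ (i * b + p, j * b + q) = \<Phi> (mat_unit a i j) $$ (p, q)"
    if "i < a" "j < a" "p < b" "q < b" for i j p q
  proof -
    have "Y $$ (i * b + p, j * b + q) = (\<Sum>i'<a. \<Sum>j'<a. \<Sum>k<a. \<Sum>l<a.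
        X $$ (i' * a + k, j' * a + l) * kron (mat_unit a i' j') (\<Phi> (mat_unit a k l)) $$ (i * b + p, j * b + q))"
      using that by (simp add: Y_def map_tensor_def add_mult_less)
    also have "\<dots> = (\<Sum>i'<a. \<Sum>j'<a. \<Sum>k<a. \<Sum>l<a. if l = j' then (if k = i' then (if i' = i \<and> j' = j then \<Phi> (mat_unit a i j) $$ (p, q) else 0) else 0) else 0)"
    proof (intro sum.cong refl)
      fix i' j' k l assume "i' \<in> {..<a}" "j' \<in> {..<a}" "k \<in> {..<a}" "l \<in> {..<a}"
      then have h: "i' < a" "j' < a" "k < a" "l < a" by auto
      have "X $$ (i' * a + k, j' * a + l) = (if i' = k \<and> j' = l then 1 else 0)"
        using h add_mult_less[of i' a k a] add_mult_less[of j' a l a] by (simp add: X_def x_def)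
      moreover have "kron (mat_unit a i' j') (\<Phi> (mat_unit a k l)) $$ (i * b + p, j * b + q)
          = mat_unit a i' j' $$ (i, j) * \<Phi> (mat_unit a k l) $$ (p, q)"
        using that kron_index[OF mat_unit_carrier[of a i' j'] \<Phi>[of k l], of "i * b + p" "j * b + q"] by (simp add: add_mult_less)
      ultimately show "X $$ (i' * a + k, j' * a + l) * kron (mat_unit a i' j') (\<Phi> (mat_unit a k l)) $$ (i * b + p, j * b + q)
         = (if l = j' then (if k = i' then (if i' = i \<and> j' = j then \<Phi> (mat_unit a i j) $$ (p, q) else 0) else 0) else 0)"
        using h that by (auto simp: mat_unit_def)
    qed
    also have "\<dots> = (\<Sum>i'<a. \<Sum>j'<a. if i' = i \<and> j' = j then \<Phi> (mat_unit a i j) $$ (p, q) else 0)"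
      by (intro sum.cong refl) simp
    also have "\<dots> = (\<Sum>i'<a. \<Sum>j'<a. if j' = j then (if i' = i then \<Phi> (mat_unit a i j) $$ (p, q) else 0) else 0)"
      by (intro sum.cong refl) auto
    also have "\<dots> = \<Phi> (mat_unit a i j) $$ (p, q)" using that by simp
    finally show ?thesis .
  qed
  obtain U d where U: "unitary (a * b) U" "Y = spectral_form (a * b) U d" "\<And>k. k < a * b \<Longrightarrow> 0 \<le> d k"
    using psd_spectral[OF Y] by blast
  \<comment> \<open>An eigenvector scaled by the square root of its eigenvalue and reshaped into a
    matrix through the index pair (i, p).\<close>
  define v where "v r i p = sqrt (d r) * U $$ (i * b + p, r)" for r i p
  have "kraus_map a b \<Phi> (a * b) v" unfolding kraus_map_def
  proof (intro allI impI)
    fix i j p q assume h: "i < a" "j < a" "p < b" "q < b"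
    have "\<Phi> (mat_unit a i j) $$ (p, q) = (\<Sum>r<a * b. U $$ (i * b + p, r) * d r * cnj (U $$ (j * b + q, r)))"
      using YE[OF h] spectral_form_index[OF unitary_carrier[OF U(1)], of "i * b + p" "j * b + q" d] h
      unfolding U(2) by (simp add: add_mult_less)
    also have "\<dots> = (\<Sum>r<a * b. v r i p * cnj (v r j q))"
    proof (rule sum.cong)
      fix r assume "r \<in> {..<a * b}"
      then have "0 \<le> d r" using U(3) by simp
      then have "complex_of_real (d r) = complex_of_real (sqrt (d r)) * complex_of_real (sqrt (d r))"
        by (simp flip: of_real_mult)
      then show "U $$ (i * b + p, r) * d r * cnj (U $$ (j * b + q, r)) = v r i p * cnj (v r j q)"
        by (simp add: v_def)
    qed simp
    finally show "\<Phi> (mat_unit a i j) $$ (p, q) = (\<Sum>r<a * b. v r i p * cnj (v r j q))" .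
  qed
  then show ?thesis by blast
qed

lemma cptp_kraus_channel: "cptp a b \<Phi> \<Longrightarrow> kraus_channel a b \<Phi>"
  by (auto simp: cptp_def kraus_channel_def completely_positive_kraus mat_trace_mat_unit)

text \<open>Base case for tensor powers: with no channel use the spaces have dimension
  \<open>a ^ 0 = 1\<close>.\<close>

lemma kraus_channel_id: "kraus_channel 1 1 (\<lambda>X. X)"
proof -
  have "kraus_map 1 1 (\<lambda>X. X) 1 (\<lambda>r i p. 1)" by (simp add: kraus_map_def mat_unit_def)
  then show ?thesis by (auto simp: kraus_channel_def linear_mat_map_def mat_trace_mat_unit)
qed

lemma kraus_channel_tensor:
  assumes \<Phi>: "kraus_channel a1 b1 \<Phi>" and \<Psi>: "kraus_channel a2 b2 \<Psi>"
  shows "kraus_channel (a1 * a2) (b1 * b2) (map_tensor a1 b1 a2 b2 \<Phi> \<Psi>)"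
proof -
  note l = kraus_channel_linear[OF \<Phi>] kraus_channel_linear[OF \<Psi>]
  note c = linear_mat_map_carrier[OF l(1) mat_unit_carrier] linear_mat_map_carrier[OF l(2) mat_unit_carrier]
  obtain R1 v1 where v1: "kraus_map a1 b1 \<Phi> R1 v1" using \<Phi> by (auto simp: kraus_channel_def)
  obtain R2 v2 where v2: "kraus_map a2 b2 \<Psi> R2 v2" using \<Psi> by (auto simp: kraus_channel_def)
  \<comment> \<open>Kronecker products of one Kraus operator from each factor, with the pair of
    labels coded in \<open>r\<close>.\<close>
  define w where "w r i p = v1 (r div R2) (i div a2) (p div b2) * v2 (r mod R2) (i mod a2) (p mod b2)" for r i p
  have "kraus_map (a1 * a2) (b1 * b2) (map_tensor a1 b1 a2 b2 \<Phi> \<Psi>) (R1 * R2) w"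
    unfolding kraus_map_def
  proof (intro allI impI)
    fix i j p q assume h: "i < a1 * a2" "j < a1 * a2" "p < b1 * b2" "q < b1 * b2"
    note d = div_mod_less[OF h(1)] div_mod_less[OF h(2)] div_mod_less[OF h(3)] div_mod_less[OF h(4)]
    have "map_tensor a1 b1 a2 b2 \<Phi> \<Psi> (mat_unit (a1 * a2) i j) $$ (p, q)
        = \<Phi> (mat_unit a1 (i div a2) (j div a2)) $$ (p div b2, q div b2) * \<Psi> (mat_unit a2 (i mod a2) (j mod a2)) $$ (p mod b2, q mod b2)"
      unfolding map_tensor_mat_unit[OF l h(1,2)] by (rule kron_index[OF c h(3,4)])
    also have "\<dots> = (\<Sum>r<R1. v1 r (i div a2) (p div b2) * cnj (v1 r (j div a2) (q div b2)))
        * (\<Sum>r<R2. v2 r (i mod a2) (p mod b2) * cnj (v2 r (j mod a2) (q mod b2)))"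
      using v1 v2 d by (simp add: kraus_map_def)
    also have "\<dots> = (\<Sum>r<R1 * R2. w r i p * cnj (w r j q))"
      unfolding sum_product sum_div_mod[symmetric] w_def by (intro sum.cong refl) simp
    finally show "map_tensor a1 b1 a2 b2 \<Phi> \<Psi> (mat_unit (a1 * a2) i j) $$ (p, q) = (\<Sum>r<R1 * R2. w r i p * cnj (w r j q))" .
  qed
  moreover have "mat_trace (map_tensor a1 b1 a2 b2 \<Phi> \<Psi> (mat_unit (a1 * a2) i j)) = (if i = j then 1 else 0)"
    if h: "i < a1 * a2" "j < a1 * a2" for i j
  proof -
    note d = div_mod_less[OF h(1)] div_mod_less[OF h(2)]
    have "i = j \<longleftrightarrow> i div a2 = j div a2 \<and> i mod a2 = j mod a2" by (metis div_mult_mod_eq)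
    then show ?thesis
      unfolding map_tensor_mat_unit[OF l h] mat_trace_kron[OF c] using \<Phi> \<Psi> d by (simp add: kraus_channel_def)
  qed
  ultimately show ?thesis using linear_map_tensor unfolding kraus_channel_def by blast
qed

lemma kraus_channel_power: "kraus_channel a b \<Phi> \<Longrightarrow> kraus_channel (a ^ n) (b ^ n) (map_tensor_power a b \<Phi> n)"
  by (induction n) (simp_all add: kraus_channel_id[simplified] kraus_channel_tensor)

text \<open>The form of the output at f is a sum over r of the form of \<open>X\<close> at g_r, the
  adjoint of the r-th Kraus operator applied to f.\<close>

lemma kraus_channel_psd:
  assumes \<Phi>: "kraus_channel a b \<Phi>" and X: "psd a X"
  shows "psd b (\<Phi> X)"
proof -
  note l = kraus_channel_linear[OF \<Phi>]
  obtain R v where v: "kraus_map a b \<Phi> R v" using \<Phi> by (auto simp: kraus_channel_def)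
  have "0 \<le> qform b (\<Phi> X) f" for f
  proof -
    define g where "g r j = (\<Sum>q<b. cnj (v r j q) * f q)" for r j
    have "qform b (\<Phi> X) f = (\<Sum>p<b. \<Sum>q<b. cnj (f p) * (\<Sum>i<a. \<Sum>j<a. X $$ (i, j) * (\<Sum>r<R. v r i p * cnj (v r j q))) * f q)"
      using v by (simp add: qform_def linear_mat_map_expand[OF l psd_carrier[OF X]] kraus_map_def)
    also have "\<dots> = (\<Sum>p<b. \<Sum>q<b. \<Sum>i<a. \<Sum>j<a. \<Sum>r<R. (v r i p * cnj (f p)) * X $$ (i, j) * (cnj (v r j q) * f q))"
      by (simp add: sum_distrib_left sum_distrib_right mult_ac)
    also have "\<dots> = (\<Sum>(p, q, i, j, r)\<in>{..<b} \<times> {..<b} \<times> {..<a} \<times> {..<a} \<times> {..<R}.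
        (v r i p * cnj (f p)) * X $$ (i, j) * (cnj (v r j q) * f q))"
      by (simp add: sum.cartesian_product)
    also have "\<dots> = (\<Sum>(r, i, j, p, q)\<in>{..<R} \<times> {..<a} \<times> {..<a} \<times> {..<b} \<times> {..<b}.
        (v r i p * cnj (f p)) * X $$ (i, j) * (cnj (v r j q) * f q))"
      by (rule sum.reindex_bij_witness[where i = "\<lambda>(r, i, j, p, q). (p, q, i, j, r)" and j = "\<lambda>(p, q, i, j, r). (r, i, j, p, q)"]) auto
    also have "\<dots> = (\<Sum>r<R. \<Sum>i<a. \<Sum>j<a. \<Sum>p<b. \<Sum>q<b. (v r i p * cnj (f p)) * X $$ (i, j) * (cnj (v r j q) * f q))"
      by (simp add: sum.cartesian_product)
    also have "\<dots> = (\<Sum>r<R. qform a X (g r))"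
      unfolding qform_def
    proof (intro sum.cong refl)
      fix r i j
      have "(\<Sum>p<b. \<Sum>q<b. (v r i p * cnj (f p)) * X $$ (i, j) * (cnj (v r j q) * f q))
          = (\<Sum>p<b. v r i p * cnj (f p) * X $$ (i, j)) * (\<Sum>q<b. cnj (v r j q) * f q)"
        by (rule sum_product[symmetric])
      then show "(\<Sum>p<b. \<Sum>q<b. (v r i p * cnj (f p)) * X $$ (i, j) * (cnj (v r j q) * f q)) = cnj (g r i) * X $$ (i, j) * g r j"
        by (simp add: g_def sum_distrib_right)
    qed
    finally show ?thesis
      using X by (simp add: psd_iff_qform less_eq_complex_def sum_nonneg)
  qed
  then show ?thesis using linear_mat_map_carrier[OF l psd_carrier[OF X]] by (simp add: psd_iff_qform)
qed

section \<open>Splitting tensor powers into blocks of channel uses\<close>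

lemma map_tensor_power_linear:
  "kraus_channel a b \<Phi> \<Longrightarrow> linear_mat_map (a ^ n) (b ^ n) (map_tensor_power a b \<Phi> n)"
  by (intro kraus_channel_linear kraus_channel_power)

text \<open>Both sides are linear in \<open>X\<close>, so the induction step only needs products of matrix units, where
  \<open>map_tensor_kron\<close> applies.\<close>

lemma map_tensor_power_add:
  assumes \<Phi>: "kraus_channel a b \<Phi>" and X: "X \<in> carrier_mat (a ^ m) (a ^ m)" and Y: "Y \<in> carrier_mat (a ^ n) (a ^ n)"
  shows "map_tensor_power a b \<Phi> (m + n) (kron X Y) = kron (map_tensor_power a b \<Phi> m X) (map_tensor_power a b \<Phi> n Y)"
  using X
proof (induction m arbitrary: X)
  note lin = map_tensor_power_linear[OF \<Phi>]
  have *: "linear_mat_map (a ^ m) (b ^ (m + n)) (\<lambda>X. map_tensor_power a b \<Phi> (m + n) (kron X Y))"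
    "linear_mat_map (a ^ m) (b ^ (m + n)) (\<lambda>X. kron (map_tensor_power a b \<Phi> m X) (map_tensor_power a b \<Phi> n Y))" for m
  proof -
    have "kron X Y \<in> carrier_mat (a ^ (m + n)) (a ^ (m + n))" if "X \<in> carrier_mat (a ^ m) (a ^ m)" for X
      using kron_carrier[OF that Y] by (simp add: power_add)
    then show "linear_mat_map (a ^ m) (b ^ (m + n)) (\<lambda>X. map_tensor_power a b \<Phi> (m + n) (kron X Y))"
      using lin[of "m + n"] unfolding linear_mat_map_def by (simp add: kron_add_left kron_smult_left)
    have "kron X (map_tensor_power a b \<Phi> n Y) \<in> carrier_mat (b ^ (m + n)) (b ^ (m + n))"
      if "X \<in> carrier_mat (b ^ m) (b ^ m)" for X
      using kron_carrier[OF that linear_mat_map_carrier[OF lin Y]] by (simp add: power_add)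
    then show "linear_mat_map (a ^ m) (b ^ (m + n)) (\<lambda>X. kron (map_tensor_power a b \<Phi> m X) (map_tensor_power a b \<Phi> n Y))"
      using lin[of m] unfolding linear_mat_map_def
      by (auto simp: kron_add_left[of _ "b ^ m" "b ^ m"] kron_smult_left)
  qed
  {
    case 0
    \<comment> \<open>In dimension \<open>a ^ 0 = 1\<close> this is the only matrix unit, and it is
      neutral for \<open>kron\<close>.\<close>
    have 1: "kron (mat_unit 1 0 0) Z = Z" for Z
      by (intro eq_matI) (auto simp: kron_def mat_unit_def)
    show ?case
      by (rule linear_mat_map_eqI[OF *[of 0] _ 0]) (use 1 in simp)
  next
    case (Suc m)
    show ?case
    proof (rule linear_mat_map_eqI[OF *[of "Suc m"] _ Suc.prems])
      fix i j assume "i < a ^ Suc m" "j < a ^ Suc m"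
      then have ij: "i < a * a ^ m" "j < a * a ^ m" by simp_all
      define E where "E = mat_unit a (i div a ^ m) (j div a ^ m)"
      define E' where "E' = mat_unit (a ^ m) (i mod a ^ m) (j mod a ^ m)"
      have E: "E \<in> carrier_mat a a" "E' \<in> carrier_mat (a ^ m) (a ^ m)" by (simp_all add: E_def E'_def)
      have u: "mat_unit (a ^ Suc m) i j = kron E E'"
        using kron_mat_unit[OF ij] by (simp add: E_def E'_def)
      have EY: "kron E' Y \<in> carrier_mat (a ^ (m + n)) (a ^ (m + n))"
        using kron_carrier[OF E(2) Y] by (simp add: power_add)
      note l1 = kraus_channel_linear[OF \<Phi>]
      \<comment> \<open>Associativity puts a single-use factor in front, where the recursive
        definition and \<open>map_tensor_kron\<close> apply.\<close>
      have "map_tensor_power a b \<Phi> (Suc m + n) (kron (kron E E') Y) = kron (\<Phi> E) (map_tensor_power a b \<Phi> (m + n) (kron E' Y))"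
        by (simp add: kron_assoc map_tensor_kron[OF l1 lin E(1) EY])
      also have "\<dots> = kron (kron (\<Phi> E) (map_tensor_power a b \<Phi> m E')) (map_tensor_power a b \<Phi> n Y)"
        by (simp add: Suc.IH[OF E(2)] kron_assoc)
      also have "kron (\<Phi> E) (map_tensor_power a b \<Phi> m E') = map_tensor_power a b \<Phi> (Suc m) (kron E E')"
        by (simp add: map_tensor_kron[OF l1 lin E])
      finally show "map_tensor_power a b \<Phi> (Suc m + n) (kron (mat_unit (a ^ Suc m) i j) Y)
          = kron (map_tensor_power a b \<Phi> (Suc m) (mat_unit (a ^ Suc m) i j)) (map_tensor_power a b \<Phi> n Y)"
        unfolding u .
    qed
  }
qed

subsection \<open>The achievability bound\<close>

lemma mat_trace_smult: "A \<in> carrier_mat n n \<Longrightarrow> mat_trace (c \<cdot>\<^sub>m A) = c * mat_trace A"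
  by (simp add: mat_trace_def sum_distrib_left)

lemma petz_overlap_smult_right:
  assumes "psd n \<rho>" "psd n \<sigma>"
  shows "petz_overlap \<alpha> \<rho> (complex_of_real c \<cdot>\<^sub>m \<sigma>) = c powr (1 - \<alpha>) * petz_overlap \<alpha> \<rho> \<sigma>"
proof -
  have c: "mat_powr \<rho> \<alpha> \<in> carrier_mat n n" "mat_powr \<sigma> (1 - \<alpha>) \<in> carrier_mat n n"
    using assms by (auto intro: mat_powr_carrier)
  then show ?thesis
    unfolding petz_overlap_def mat_powr_smult[OF assms(2)] mult_smult_distrib[OF c]
    by (simp add: mat_trace_smult[of _ n])
qed

text \<open>Audenaert's inequality for \<open>A\<close> and \<open>l\<close> times \<open>B\<close>.
  Both error terms are nonnegative, so the bound l 2^(-x) on their sum holds for each; dividing by l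
  gives the type-II part.\<close>

lemma hoeffding_test:
  assumes A: "psd n A" and B: "psd n B" and \<alpha>: "0 < \<alpha>" "\<alpha> < 1"
    and L: "petz_overlap \<alpha> A B \<le> L" "0 < L"
  shows "\<exists>T. effect n T \<and> Re (mat_trace (T * B)) \<le> 2 powr - x \<and>
    Re (mat_trace ((1\<^sub>m n - T) * A)) \<le> (L * 2 powr x) powr (1 / \<alpha>) * 2 powr - x"
proof -
  \<comment> \<open>The solution of l^(1-\<alpha>) L = l 2^(-x).\<close>
  define l where "l = (L * 2 powr x) powr (1 / \<alpha>)"
  have l: "0 < l" using L by (simp add: l_def)
  have la: "l powr \<alpha> = L * 2 powr x" using L \<alpha> by (simp add: l_def powr_powr)
  have "l = l powr \<alpha> * l powr (1 - \<alpha>)" using l by (simp flip: powr_add)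
  then have "2 powr - x * l = (2 powr - x * 2 powr x) * (L * l powr (1 - \<alpha>))" unfolding la by (simp add: mult_ac)
  then have lL: "l powr (1 - \<alpha>) * L = l * 2 powr - x" by (simp add: mult.commute flip: powr_add)
  have lB: "psd n (complex_of_real l \<cdot>\<^sub>m B)" using B l by (intro psd_smult) auto
  obtain T where T: "effect n T"
    and le: "Re (mat_trace ((1\<^sub>m n - T) * A)) + Re (mat_trace (T * (complex_of_real l \<cdot>\<^sub>m B)))
      \<le> petz_overlap \<alpha> A (complex_of_real l \<cdot>\<^sub>m B)"
    using audenaert_test[OF A lB \<alpha>] unfolding petz_overlap_def by blast
  have T': "psd n T" "psd n (1\<^sub>m n - T)" using T by (auto simp: effect_def)
  have "mat_trace (T * (complex_of_real l \<cdot>\<^sub>m B)) = l * mat_trace (T * B)"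
    using psd_carrier[OF T'(1)] psd_carrier[OF B]
    by (simp add: mult_smult_distrib[of _ n n _ n] mat_trace_smult[of _ n])
  moreover have "petz_overlap \<alpha> A (complex_of_real l \<cdot>\<^sub>m B) \<le> l * 2 powr - x"
    unfolding petz_overlap_smult_right[OF A B] lL[symmetric] using L by (intro mult_left_mono) auto
  ultimately have "Re (mat_trace ((1\<^sub>m n - T) * A)) + l * Re (mat_trace (T * B)) \<le> l * 2 powr - x"
    using le by simp
  moreover have "0 \<le> Re (mat_trace ((1\<^sub>m n - T) * A))" "0 \<le> l * Re (mat_trace (T * B))"
    using psd_trace_mult_nonneg[OF T'(2) A] psd_trace_mult_nonneg[OF T'(1) B] l by auto
  ultimately have "Re (mat_trace ((1\<^sub>m n - T) * A)) \<le> l * 2 powr - x" "l * Re (mat_trace (T * B)) \<le> l * 2 powr - x"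
    by linarith+
  then show ?thesis using T l unfolding l_def[symmetric] by auto
qed

section \<open>Input states of every length with controlled overlap\<close>

lemma density_op_mat_unit:
  assumes "0 < d"
  shows "density_op d (mat_unit d 0 0)"
proof -
  have "psd d (mat_unit d 0 0)" unfolding psd_iff_qform
  proof (intro conjI allI)
    fix f
    have "qform d (mat_unit d 0 0) f = (\<Sum>i<d. \<Sum>j<d. if j = 0 then (if i = 0 then cnj (f 0) * f 0 else 0) else 0)"
      unfolding qform_def by (intro sum.cong refl) (auto simp: mat_unit_def)
    also have "\<dots> = complex_of_real ((cmod (f 0))\<^sup>2)"
      using assms by (simp only: complex_norm_square mult.commute) simp
    finally show "0 \<le> qform d (mat_unit d 0 0) f" by (simp add: less_eq_complex_def)
  qed simp
  then show ?thesis using assms by (simp add: density_op_def mat_trace_mat_unit)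
qed

text \<open>In dimension 0 the trace is an empty sum and cannot be 1.\<close>

lemma density_op_dim_pos: "density_op d \<rho> \<Longrightarrow> 0 < d"
  by (cases d) (auto simp: density_op_def psd_def mat_trace_def)

text \<open>Strong induction on the length: for n \<ge> m one good block is split off and
  contributes at most the factor \<theta>^m, so \<open>K\<close> does not grow. Lengths below
  \<open>m\<close> are served by a fixed pure state.\<close>

lemma overlap_of_tensor_powers:
  assumes N: "kraus_channel a b N" and M: "kraus_channel a b M" and m: "1 \<le> m"
    and \<rho>: "density_op (a ^ m) \<rho>" and \<theta>: "0 < \<theta>"
    and le: "petz_overlap \<alpha> (map_tensor_power a b N m \<rho>) (map_tensor_power a b M m \<rho>) \<le> \<theta> ^ m"
  shows "\<exists>K>0. \<forall>n. \<exists>\<psi>. density_op (a ^ n) \<psi> \<and>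
    petz_overlap \<alpha> (map_tensor_power a b N n \<psi>) (map_tensor_power a b M n \<psi>) \<le> K * \<theta> ^ n"
proof -
  define Q where "Q n \<psi> = petz_overlap \<alpha> (map_tensor_power a b N n \<psi>) (map_tensor_power a b M n \<psi>)" for n \<psi>
  have psd: "psd (b ^ n) (map_tensor_power a b N n \<psi>)" "psd (b ^ n) (map_tensor_power a b M n \<psi>)"
    if "density_op (a ^ n) \<psi>" for n \<psi>
    using that kraus_channel_psd[OF kraus_channel_power[OF N]] kraus_channel_psd[OF kraus_channel_power[OF M]]
    by (auto simp: density_op_def)
  have Q0: "0 \<le> Q n \<psi>" if "density_op (a ^ n) \<psi>" for n \<psi>
    unfolding Q_def using psd[OF that] by (rule petz_overlap_nonneg)
  \<comment> \<open>A state of length m \<ge> 1 exists, so the input space is nonzero and padding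
    states exist at every length.\<close>
  have "0 < a" using density_op_dim_pos[OF \<rho>] m by (cases a) (auto simp: zero_power)
  define \<omega> where "\<omega> j = mat_unit (a ^ j) 0 0" for j
  have \<omega>: "density_op (a ^ j) (\<omega> j)" for j
    unfolding \<omega>_def using \<open>0 < a\<close> by (intro density_op_mat_unit) simp
  \<comment> \<open>The sum covers the finitely many lengths below \<open>m\<close> at once; the
    summand 1 keeps \<open>K\<close> positive even if all these overlaps vanish.\<close>
  define K where "K = 1 + (\<Sum>j<m. Q j (\<omega> j) / \<theta> ^ j)"
  have K0: "0 < K" unfolding K_def using \<theta> Q0[OF \<omega>] by (intro add_pos_nonneg sum_nonneg) auto
  have "\<exists>\<psi>. density_op (a ^ n) \<psi> \<and> Q n \<psi> \<le> K * \<theta> ^ n" for n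
  proof (induction n rule: less_induct)
    case (less n)
    show ?case
    proof (cases "n < m")
      case True
      have "Q n (\<omega> n) / \<theta> ^ n \<le> (\<Sum>j<m. Q j (\<omega> j) / \<theta> ^ j)"
        using True \<theta> Q0[OF \<omega>] by (intro member_le_sum) auto
      then have "Q n (\<omega> n) / \<theta> ^ n \<le> K" by (simp add: K_def)
      then have "Q n (\<omega> n) \<le> K * \<theta> ^ n" using \<theta> by (simp add: divide_le_eq)
      then show ?thesis using \<omega> by blast
    next
      case False
      then obtain k where k: "n = m + k" using le_Suc_ex not_less by blast
      with less.IH[of k] m obtain \<psi> where \<psi>: "density_op (a ^ k) \<psi>" "Q k \<psi> \<le> K * \<theta> ^ k" by auto
      have X: "\<rho> \<in> carrier_mat (a ^ m) (a ^ m)" "\<psi> \<in> carrier_mat (a ^ k) (a ^ k)"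
        using \<rho> \<psi>(1) by (auto simp: density_op_def psd_def)
      have "Q n (kron \<rho> \<psi>) = Q m \<rho> * Q k \<psi>"
        unfolding Q_def k map_tensor_power_add[OF N X] map_tensor_power_add[OF M X]
        by (rule petz_overlap_kron[OF psd[OF \<rho>] psd[OF \<psi>(1)]])
      also have "\<dots> \<le> \<theta> ^ m * (K * \<theta> ^ k)"
        using le \<psi>(2) \<theta> Q0[OF \<psi>(1)] unfolding Q_def[symmetric] by (intro mult_mono) auto
      also have "\<dots> = K * \<theta> ^ n" by (simp add: k power_add)
      finally show ?thesis using density_op_kron[OF \<rho> \<psi>(1)] by (auto simp: k power_add)
    qed
  qed
  then show ?thesis using K0 unfolding Q_def by blast
qed

section \<open>From tests at each length to the error exponent\<close>

lemma elog2_le: "x \<le> y \<Longrightarrow> 0 < y \<Longrightarrow> elog2 x \<le> ereal (log 2 y)"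
  by (auto simp: elog2_def)

text \<open>A strict lower bound c on a supremum is witnessed by one block length and one input,
  even if the supremum is infinite or not attained; that input generates the whole strategy.\<close>

lemma error_exponent_coh_ge:
  assumes N: "kraus_channel a b N" and M: "kraus_channel a b M" and \<alpha>: "0 < \<alpha>" "\<alpha> < 1"
    and c: "ereal c < reg_channel_div \<alpha> a b N M"
  shows "ereal ((1 - \<alpha>) / \<alpha> * (c - r)) \<le> error_exponent_coh r a b N M"
proof -
  let ?N = "map_tensor_power a b N" and ?M = "map_tensor_power a b M"
  obtain m where m: "1 \<le> m" and "ereal c < ereal (1 / real m) * channel_div \<alpha> (a ^ m) (?N m) (?M m)"
    using c unfolding reg_channel_div_def less_SUP_iff by auto
  then have "ereal (real m * c) < channel_div \<alpha> (a ^ m) (?N m) (?M m)"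
    by (cases "channel_div \<alpha> (a ^ m) (?N m) (?M m)") (auto simp: field_simps)
  then obtain \<rho> where \<rho>: "density_op (a ^ m) \<rho>" and div: "ereal (real m * c) < petz_div \<alpha> (?N m \<rho>) (?M m \<rho>)"
    unfolding channel_div_def less_SUP_iff by auto
  \<comment> \<open>For nonzero overlap, a divergence above m c means an overlap below \<theta>^m;
    the factor \<alpha> - 1 is negative and reverses the order.\<close>
  define \<theta> where "\<theta> = 2 powr ((\<alpha> - 1) * c)"
  have \<theta>: "0 < \<theta>" "log 2 \<theta> = (\<alpha> - 1) * c" by (simp_all add: \<theta>_def)
  define Q where "Q = petz_overlap \<alpha> (?N m \<rho>) (?M m \<rho>)"
  have "psd (b ^ m) (?N m \<rho>)" "psd (b ^ m) (?M m \<rho>)"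
    using \<rho> kraus_channel_psd[OF kraus_channel_power[OF N]] kraus_channel_psd[OF kraus_channel_power[OF M]]
    by (auto simp: density_op_def)
  then have Q0: "0 \<le> Q" unfolding Q_def by (rule petz_overlap_nonneg)
  have "Q \<le> \<theta> ^ m"
  proof (cases "Q = 0")
    case True
    then show ?thesis using \<theta> by simp
  next
    case False
    then have "real m * c < 1 / (\<alpha> - 1) * log 2 Q"
      using div by (simp add: petz_div_def petz_overlap_def Q_def Let_def)
    then have "log 2 Q < real m * ((\<alpha> - 1) * c)"
      using \<alpha> by (simp add: field_simps)
    also have "\<dots> = log 2 (\<theta> ^ m)" using \<theta> by (simp add: log_nat_power)
    finally show ?thesis using False Q0 \<theta> by simp
  qed
  from overlap_of_tensor_powers[OF N M m \<rho> \<theta>(1) this[unfolded Q_def]] obtain K where K: "0 < K"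
    and ex: "\<And>n. \<exists>\<psi>. density_op (a ^ n) \<psi> \<and> petz_overlap \<alpha> (?N n \<psi>) (?M n \<psi>) \<le> K * \<theta> ^ n"
    by blast
  \<comment> \<open>The type-I bound of \<open>hoeffding_test\<close> at L = K \<theta>^n and x = n
    r.\<close>
  define bnd where "bnd n = (K * \<theta> ^ n * 2 powr (real n * r)) powr (1 / \<alpha>) * 2 powr - (real n * r)" for n
  have "\<exists>\<psi> T. density_op (a ^ n) \<psi> \<and> effect (b ^ n) T \<and>
      type2_error a b M n \<psi> T \<le> 2 powr - (real n * r) \<and> type1_error a b N n \<psi> T \<le> bnd n" for n
  proof -
    obtain \<psi> where \<psi>: "density_op (a ^ n) \<psi>" "petz_overlap \<alpha> (?N n \<psi>) (?M n \<psi>) \<le> K * \<theta> ^ n"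
      using ex by blast
    have "psd (b ^ n) (?N n \<psi>)" "psd (b ^ n) (?M n \<psi>)"
      using \<psi>(1) kraus_channel_psd[OF kraus_channel_power[OF N]] kraus_channel_psd[OF kraus_channel_power[OF M]]
      by (auto simp: density_op_def)
    from hoeffding_test[OF this \<alpha> \<psi>(2), of "real n * r"] K \<theta> \<psi>(1) show ?thesis
      unfolding type1_error_def type2_error_def bnd_def by auto
  qed
  then obtain \<psi> T where \<psi>T: "\<And>n. density_op (a ^ n) (\<psi> n)" "\<And>n. effect (b ^ n) (T n)"
      "\<And>n. type2_error a b M n (\<psi> n) (T n) \<le> 2 powr - (real n * r)"
      "\<And>n. type1_error a b N n (\<psi> n) (T n) \<le> bnd n"
    by metis
  have "limsup (\<lambda>n. ereal (1 / real n) * elog2 (type2_error a b M n (\<psi> n) (T n))) \<le> limsup (\<lambda>n. ereal (- r))"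
  proof (intro Limsup_mono eventually_sequentiallyI)
    \<comment> \<open>At n = 0 the prefactor \<open>1 / real n\<close> is 0, so the estimate starts
      at 1, which the upper limit does not see.\<close>
    fix n :: nat assume n: "1 \<le> n"
    have "ereal (1 / real n) * elog2 (type2_error a b M n (\<psi> n) (T n)) \<le> ereal (1 / real n) * ereal (log 2 (2 powr - (real n * r)))"
      by (intro ereal_mult_left_mono elog2_le \<psi>T(3)) auto
    also have "\<dots> = ereal (- r)" using n by simp
    finally show "ereal (1 / real n) * elog2 (type2_error a b M n (\<psi> n) (T n)) \<le> ereal (- r)" .
  qed
  then have t2: "limsup (\<lambda>n. ereal (1 / real n) * elog2 (type2_error a b M n (\<psi> n) (T n))) \<le> ereal (- r)"
    by (simp add: Limsup_const)
  \<comment> \<open>The normalized logarithm of \<open>bnd n\<close>; the constant \<open>K\<close>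
    enters only through log K / n, which tends to 0.\<close>
  define g where "g n = 1 / \<alpha> * (log 2 K * (1 / real n) + (\<alpha> - 1) * c + r) - r" for n
  have "limsup (\<lambda>n. ereal (1 / real n) * elog2 (type1_error a b N n (\<psi> n) (T n))) \<le> limsup (\<lambda>n. ereal (g n))"
  proof (intro Limsup_mono eventually_sequentiallyI)
    fix n :: nat assume n: "1 \<le> n"
    have b0: "0 < bnd n" using K \<theta> by (simp add: bnd_def)
    have "log 2 (bnd n) = 1 / \<alpha> * log 2 (K * \<theta> ^ n * 2 powr (real n * r)) - real n * r"
      using K \<theta> unfolding bnd_def by (simp add: log_mult log_powr)
    also have "log 2 (K * \<theta> ^ n * 2 powr (real n * r)) = log 2 K + real n * ((\<alpha> - 1) * c) + real n * r"
      using K \<theta> by (simp add: log_mult log_nat_power)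
    finally have lb: "1 / real n * log 2 (bnd n) = g n" using n \<alpha> by (simp add: g_def field_simps)
    have "ereal (1 / real n) * elog2 (type1_error a b N n (\<psi> n) (T n)) \<le> ereal (1 / real n) * ereal (log 2 (bnd n))"
      by (intro ereal_mult_left_mono elog2_le \<psi>T(4) b0) auto
    also have "\<dots> = ereal (g n)" using lb by simp
    finally show "ereal (1 / real n) * elog2 (type1_error a b N n (\<psi> n) (T n)) \<le> ereal (g n)" .
  qed
  also have "limsup (\<lambda>n. ereal (g n)) = ereal (1 / \<alpha> * (log 2 K * 0 + (\<alpha> - 1) * c + r) - r)"
    unfolding g_def by (intro lim_imp_Limsup tendsto_intros lim_1_over_n) simp
  also have "1 / \<alpha> * (log 2 K * 0 + (\<alpha> - 1) * c + r) - r = - ((1 - \<alpha>) / \<alpha> * (c - r))"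
    using \<alpha> by (simp add: field_simps)
  finally have t1: "limsup (\<lambda>n. ereal (1 / real n) * elog2 (type1_error a b N n (\<psi> n) (T n)))
      \<le> ereal (- ((1 - \<alpha>) / \<alpha> * (c - r)))" .
  have "ereal ((1 - \<alpha>) / \<alpha> * (c - r)) = - ereal (- ((1 - \<alpha>) / \<alpha> * (c - r)))" by simp
  also have "\<dots> \<le> - limsup (\<lambda>n. ereal (1 / real n) * elog2 (type1_error a b N n (\<psi> n) (T n)))"
    using t1 by (simp only: ereal_minus_le_minus)
  also have "\<dots> \<le> error_exponent_coh r a b N M"
    unfolding error_exponent_coh_def
    by (rule Sup_upper) (use \<psi>T(1,2) t2 in \<open>auto simp: coh_strategies_def\<close>)
  finally show ?thesis .
qed

theorem theorem32:
  fixes dA dB :: nat and N M :: "complex mat \<Rightarrow> complex mat" and r :: real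
  assumes "cptp dA dB N" and "cptp dA dB M" and "r > 0"
  shows "error_exponent_coh r dA dB N M \<ge>
    (SUP \<alpha>\<in>{0<..<1}. ereal ((\<alpha> - 1) / \<alpha>) * (ereal r - reg_channel_div \<alpha> dA dB N M))"
proof (rule SUP_least)
  fix \<alpha> :: real assume "\<alpha> \<in> {0<..<1}"
  then have \<alpha>: "0 < \<alpha>" "\<alpha> < 1" by auto
  show "ereal ((\<alpha> - 1) / \<alpha>) * (ereal r - reg_channel_div \<alpha> dA dB N M) \<le> error_exponent_coh r dA dB N M"
  \<comment> \<open>A value strictly below the target leaves room for a \<open>c\<close> strictly
    below the regularized divergence, as \<open>error_exponent_coh_ge\<close> requires.\<close>
  proof (rule dense_le)
    fix y assume y: "y < ereal ((\<alpha> - 1) / \<alpha>) * (ereal r - reg_channel_div \<alpha> dA dB N M)"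
    have neg: "(\<alpha> - 1) / \<alpha> < 0" using \<alpha> by (simp add: divide_neg_pos)
    show "y \<le> error_exponent_coh r dA dB N M"
    proof (cases y)
      case (real z)
      \<comment> \<open>The solution of (1 - \<alpha>) / \<alpha> * (c - r) = z.\<close>
      define c where "c = r + z * \<alpha> / (1 - \<alpha>)"
      have "ereal c < reg_channel_div \<alpha> dA dB N M"
      proof (cases "reg_channel_div \<alpha> dA dB N M")
        case (real R)
        then have "z < (\<alpha> - 1) / \<alpha> * (r - R)" using y \<open>y = ereal z\<close> by simp
        then have "z * \<alpha> < (1 - \<alpha>) * (R - r)" using \<alpha> by (simp add: field_simps)
        then have "c < R" using \<alpha> by (simp add: c_def field_simps)
        then show ?thesis using real by simp
      \<comment> \<open>A divergence of +infinity lies above every c; the value -infinity would make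
        the target -infinity, with nothing below it.\<close>
      qed (use y neg in \<open>auto simp: zero_ereal_def split: if_splits\<close>)
      then have "ereal ((1 - \<alpha>) / \<alpha> * (c - r)) \<le> error_exponent_coh r dA dB N M"
        by (intro error_exponent_coh_ge cptp_kraus_channel assms \<alpha>)
      moreover have "(1 - \<alpha>) / \<alpha> * (c - r) = z" using \<alpha> by (simp add: c_def)
      ultimately show ?thesis using real by simp
    \<comment> \<open>Strictness excludes y = +infinity, and y = -infinity is trivial.\<close>
    qed (use y in auto)
  qed
qed

end
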